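(* Let $K$ be a bounded linear operator from $\mathcal{H}$ to $\mathcal{H}'$ with norm strictly bounded by $1$, let $g\in\mathcal{H}'$, let $(\varphi_\gamma)_{\gamma\in\Gamma}$ be an orthonormal basis of $\mathcal{H}$, and let $p\in[1,2]$. Let $\mathbf{w}=(w_\gamma)_{\gamma\in\Gamma}$ be uniformly bounded below away from zero, i.e. there is a constant $c>0$ such that $w_\gamma\ge c$ for all $\gamma\in\Gamma$, and let $\mathbf{S}_{\mathbf{w},p}$ be the associated shrinkage operator. Then the sequence of iterates $$f^n=\mathbf{S}_{\mathbf{w},p}\big(f^{n-1}+K^*(g-Kf^{n-1})\big),\qquad n=1,2,\dots,$$ with $f^0$ arbitrarily chosen in $\mathcal{H}$, converges strongly (i.e. in the norm of $\mathcal{H}$) to a minimizer of the functional $$\Phi_{\mathbf{w},p}(f)=\|Kf-g\|^2+|||f|||_{\mathbf{w},p}^p .$$ If either $p>1$ or $\mathrm{N}(K)=\{0\}$, then the minimizer $f^\star$ of $\Phi_{\mathbf{w},p}$ is unique, and every sequence of iterates $f^n$ converges strongly to $f^\star$, regardless of the choice of $f^0$.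
   Context: $\mathcal{H},\mathcal{H}'$ are real Hilbert spaces, $K^*$ is the adjoint of $K$, and $\mathrm{N}(K)=\{f\in\mathcal{H}: Kf=0\}$. For $f\in\mathcal{H}$ write $f_\gamma=\langle f,\varphi_\gamma\rangle$, and $$|||f|||_{\mathbf{w},p}=\Big[\sum_{\gamma\in\Gamma}w_\gamma|f_\gamma|^p\Big]^{1/p}\in[0,+\infty],$$ so $\Phi_{\mathbf{w},p}$ takes values in $[0,+\infty]$. Scalar shrinkage functions $S_{w,p}:\mathbb{R}\to\mathbb{R}$ (for $w\ge 0$): for $p>1$, $S_{w,p}=(F_{w,p})^{-1}$ where $F_{w,p}(x)=x+\frac{wp}{2}\,\mathrm{sign}(x)|x|^{p-1}$ is a bijection of $\mathbb{R}$; for $p=1$, $S_{w,1}(x)=x-w/2$ if $x\ge w/2$, $S_{w,1}(x)=0$ if $|x|<w/2$, and $S_{w,1}(x)=x+w/2$ if $x\le -w/2$. The shrinkage operator is $\mathbf{S}_{\mathbf{w},p}(h)=\sum_{\gamma\in\Gamma}S_{w_\gamma,p}(h_\gamma)\varphi_\gamma$ for $h\in\mathcal{H}$. *)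

theory Defs
  imports "HOL-Analysis.Analysis"
begin

text \<open>
  Real Hilbert spaces are types of sort \<open>{real_inner, complete_space}\<close>. A basis is a family
  indexed by an arbitrary set (possibly empty or uncountable); closure is taken in the norm topology.
\<close>

definition orthonormal_basis :: "'i set \<Rightarrow> ('i \<Rightarrow> 'a::real_inner) \<Rightarrow> bool" where
  "orthonormal_basis \<Gamma> \<phi> \<longleftrightarrow>
     (\<forall>\<gamma>\<in>\<Gamma>. norm (\<phi> \<gamma>) = 1) \<and>
     (\<forall>\<gamma>\<in>\<Gamma>. \<forall>\<delta>\<in>\<Gamma>. \<gamma> \<noteq> \<delta> \<longrightarrow> \<phi> \<gamma> \<bullet> \<phi> \<delta> = 0) \<and>
     closure (span (\<phi> ` \<Gamma>)) = UNIV"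

text \<open>Real powers on \<open>[0, \<infinity>]\<close>; only positive exponents \<open>a\<close> are used, whence \<open>\<infinity>\<close> to the \<open>a\<close> is \<open>\<infinity>\<close>.\<close>

definition ennreal_powr :: "ennreal \<Rightarrow> real \<Rightarrow> ennreal" where
  "ennreal_powr x a = (if x = \<infinity> then \<infinity> else ennreal (enn2real x powr a))"

text \<open>
  The sum below is an unconditional sum in \<open>ennreal\<close>, hence always exists and may be \<open>\<infinity>\<close>.
  Since \<open>0 powr p = 0\<close>, vanishing coefficients contribute nothing.
\<close>

definition weighted_norm ::
  "'i set \<Rightarrow> ('i \<Rightarrow> 'a::real_inner) \<Rightarrow> ('i \<Rightarrow> real) \<Rightarrow> real \<Rightarrow> 'a \<Rightarrow> ennreal" where
  "weighted_norm \<Gamma> \<phi> w p f =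
     ennreal_powr (\<Sum>\<^sub>\<infinity>\<gamma>\<in>\<Gamma>. ennreal (w \<gamma> * \<bar>f \<bullet> \<phi> \<gamma>\<bar> powr p)) (1 / p)"

definition penalized_functional ::
  "('a::real_inner \<Rightarrow> 'b::real_inner) \<Rightarrow> 'b \<Rightarrow> 'i set \<Rightarrow> ('i \<Rightarrow> 'a) \<Rightarrow> ('i \<Rightarrow> real) \<Rightarrow> real \<Rightarrow> 'a \<Rightarrow> ennreal" where
  "penalized_functional K g \<Gamma> \<phi> w p f =
     ennreal ((norm (K f - g))\<^sup>2) + ennreal_powr (weighted_norm \<Gamma> \<phi> w p f) p"

definition shrink_inverse :: "real \<Rightarrow> real \<Rightarrow> real \<Rightarrow> real" where
  "shrink_inverse w p x = x + w * p / 2 * sgn x * \<bar>x\<bar> powr (p - 1)"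

text \<open>Intended for \<open>w \<ge> 0\<close> and \<open>p \<ge> 1\<close>; then \<open>shrink_inverse w p\<close> is a bijection for \<open>p > 1\<close>.\<close>

definition shrink :: "real \<Rightarrow> real \<Rightarrow> real \<Rightarrow> real" where
  "shrink w p x =
     (if p = 1 then
        (if x \<ge> w / 2 then x - w / 2
         else if \<bar>x\<bar> < w / 2 then 0
         else x + w / 2)
      else inv (shrink_inverse w p) x)"

definition shrinkage ::
  "'i set \<Rightarrow> ('i \<Rightarrow> 'a::real_inner) \<Rightarrow> ('i \<Rightarrow> real) \<Rightarrow> real \<Rightarrow> 'a \<Rightarrow> 'a" where
  "shrinkage \<Gamma> \<phi> w p h = (\<Sum>\<^sub>\<infinity>\<gamma>\<in>\<Gamma>. shrink (w \<gamma>) p (h \<bullet> \<phi> \<gamma>) *\<^sub>R \<phi> \<gamma>)"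

primrec iterate ::
  "('a::real_inner \<Rightarrow> 'b::real_inner) \<Rightarrow> 'b \<Rightarrow> 'i set \<Rightarrow> ('i \<Rightarrow> 'a) \<Rightarrow> ('i \<Rightarrow> real) \<Rightarrow> real \<Rightarrow> 'a \<Rightarrow> nat \<Rightarrow> 'a" where
  "iterate K g \<Gamma> \<phi> w p f0 0 = f0"
| "iterate K g \<Gamma> \<phi> w p f0 (Suc n) =
     shrinkage \<Gamma> \<phi> w p
       (iterate K g \<Gamma> \<phi> w p f0 n + adjoint K (g - K (iterate K g \<Gamma> \<phi> w p f0 n)))"

definition is_minimizer :: "('a \<Rightarrow> ennreal) \<Rightarrow> 'a \<Rightarrow> bool" where
  "is_minimizer F f \<longleftrightarrow> (\<forall>h. F f \<le> F h)"

end

theory Submission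
  imports Defs
begin

text \<open>
  Let \<open>T\<close> denote one step of the iteration and \<open>J\<close> the functional. Everything rests on one
  property of the scalar shrinkage function: \<open>s = S h\<close> minimizes \<open>(s - h)\<^sup>2 + w \<bar>s\<bar> powr p\<close>, because
  \<open>2 (h - s)\<close> is a subgradient of \<open>w \<bar>\<cdot>\<bar> powr p\<close> at \<open>s\<close> (\<open>shrink_subgradient\<close>). Summing this over the
  coefficients and expanding \<open>\<parallel>K z - g\<parallel>\<^sup>2\<close> around \<open>f\<close> gives, for every \<open>z\<close> of finite penalty,
  \<open>J (T f) + \<parallel>T f - f\<parallel>\<^sup>2 - \<parallel>K (T f - f)\<parallel>\<^sup>2 + \<parallel>z - T f\<parallel>\<^sup>2 + \<parallel>K (z - f)\<parallel>\<^sup>2 \<le> J z + \<parallel>z - f\<parallel>\<^sup>2\<close>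
  (\<open>step_inequality\<close>). From it one reads off that \<open>J\<close> decreases along the iterates, that
  consecutive iterates approach each other, that \<open>J (f\<^sup>n)\<close> tends to the infimum of \<open>J\<close>, and that
  minimizers and fixed points of \<open>T\<close> are the same. Since \<open>T\<close> is also nonexpansive, it is enough to
  find one strongly convergent subsequence: its limit is a fixed point, and the whole
  sequence cannot move away from it (\<open>subsequential_limit_is_limit\<close>). In particular the argument produces a minimizer.

  For \<open>p > 1\<close> the coefficients of the iterates stay in a fixed interval, on which the shrinkage
  functions are contractions with a common factor below \<open>1\<close>. Hence \<open>T\<close> contracts distances between
  iterates, and together with \<open>\<parallel>f\<^sup>n\<^sup>+\<^sup>1 - f\<^sup>n\<parallel> \<longlonglongrightarrow> 0\<close> this makes them a Cauchy sequence.

  For \<open>p = 1\<close> the squared misfit is uniformly convex in \<open>K f\<close>, so \<open>K f\<^sup>n\<close> is Cauchy for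
  the minimizing sequence \<open>f\<^sup>n\<close>, and the gradient terms \<open>K\<^sup>* (g - K f\<^sup>n)\<close> converge in norm. All but
  finitely many coefficients of their limit are at most \<open>c / 8\<close> in modulus; in those
  positions each step lowers the modulus by a fixed amount until it is \<open>0\<close>. Thus the iterates
  eventually lie in a bounded subset of a finite-dimensional subspace, which yields the
  subsequence.

  Uniqueness holds because the strengthened nonexpansiveness, applied to two fixed points with
  difference \<open>a\<close>, forces \<open>\<kappa> \<parallel>a\<parallel>\<^sup>2 + \<parallel>K a\<parallel>\<^sup>2 \<le> 0\<close> with \<open>\<kappa> \<ge> 0\<close>: if \<open>p > 1\<close> then \<open>\<kappa> > 0\<close>,
  and otherwise \<open>K a = 0\<close>, which means \<open>a = 0\<close> for injective \<open>K\<close>.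
\<close>

section \<open>Expansions in an orthonormal basis\<close>

locale orthonormal_basis_on =
  fixes \<Gamma> :: "'i set" and \<phi> :: "'i \<Rightarrow> 'a::{real_inner, complete_space}"
  assumes basis: "orthonormal_basis \<Gamma> \<phi>"
begin

lemma inner_basis:
  "\<gamma> \<in> \<Gamma> \<Longrightarrow> \<delta> \<in> \<Gamma> \<Longrightarrow> \<phi> \<gamma> \<bullet> \<phi> \<delta> = (if \<gamma> = \<delta> then 1 else 0)"
  using basis unfolding orthonormal_basis_def by (auto simp: dot_square_norm)

lemma inner_sum_basis:
  assumes "finite F" "F \<subseteq> \<Gamma>" "\<gamma> \<in> \<Gamma>"
  shows "(\<Sum>\<delta>\<in>F. a \<delta> *\<^sub>R \<phi> \<delta>) \<bullet> \<phi> \<gamma> = (if \<gamma> \<in> F then a \<gamma> else 0)"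
proof -
  have "(\<Sum>\<delta>\<in>F. a \<delta> *\<^sub>R \<phi> \<delta>) \<bullet> \<phi> \<gamma> = (\<Sum>\<delta>\<in>F. if \<delta> = \<gamma> then a \<delta> else 0)"
    unfolding inner_sum_left by (rule sum.cong) (use assms inner_basis in auto)
  then show ?thesis using assms by (simp add: sum.delta)
qed

lemma norm_sum_basis:
  assumes "finite F" "F \<subseteq> \<Gamma>"
  shows "(norm (\<Sum>\<delta>\<in>F. a \<delta> *\<^sub>R \<phi> \<delta>))\<^sup>2 = (\<Sum>\<delta>\<in>F. (a \<delta>)\<^sup>2)"
proof -
  have "(norm (\<Sum>\<delta>\<in>F. a \<delta> *\<^sub>R \<phi> \<delta>))\<^sup>2
      = (\<Sum>\<gamma>\<in>F. a \<gamma> * ((\<Sum>\<delta>\<in>F. a \<delta> *\<^sub>R \<phi> \<delta>) \<bullet> \<phi> \<gamma>))"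
    unfolding power2_norm_eq_inner inner_sum_right by simp
  also have "\<dots> = (\<Sum>\<delta>\<in>F. (a \<delta>)\<^sup>2)"
    using assms inner_sum_basis[OF assms, of _ a]
    by (intro sum.cong) (auto simp: power2_eq_square subset_iff)
  finally show ?thesis .
qed

text \<open>
  Subtracting the projection onto the span of finitely many basis vectors is a linear map that
  does not increase norms; applied to \<open>x - y\<close> with \<open>y\<close> in that span it gives the best
  approximation property used in the proof of \<open>expansion\<close>.
\<close>

lemma norm_projection_residual_le:
  assumes "finite G" "G \<subseteq> \<Gamma>"
  shows "norm (z - (\<Sum>\<gamma>\<in>G. (z \<bullet> \<phi> \<gamma>) *\<^sub>R \<phi> \<gamma>)) \<le> norm z"
proof -
  let ?P = "\<Sum>\<gamma>\<in>G. (z \<bullet> \<phi> \<gamma>) *\<^sub>R \<phi> \<gamma>"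
  have "z \<bullet> ?P = (norm ?P)\<^sup>2"
    unfolding norm_sum_basis[OF assms] by (simp add: inner_sum_right power2_eq_square)
  then have "(norm (z - ?P))\<^sup>2 = (norm z)\<^sup>2 - (norm ?P)\<^sup>2"
    by (simp add: power2_norm_eq_inner inner_diff_left inner_diff_right inner_commute)
  then have "(norm (z - ?P))\<^sup>2 \<le> (norm z)\<^sup>2" by simp
  then show ?thesis by (rule power2_le_imp_le) simp
qed

lemma expansion_of_span:
  assumes "finite G" "G \<subseteq> \<Gamma>" "y \<in> span (\<phi> ` G)"
  shows "(\<Sum>\<gamma>\<in>G. (y \<bullet> \<phi> \<gamma>) *\<^sub>R \<phi> \<gamma>) = y"
  using assms(3)
proof (induction rule: span_induct)
  case base
  show ?case unfolding subspace_def mem_Collect_eq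
    by (simp add: inner_add_left scaleR_add_left sum.distrib flip: scaleR_scaleR scaleR_sum_right)
next
  case (step x)
  then obtain \<delta> where \<delta>: "\<delta> \<in> G" "x = \<phi> \<delta>" by auto
  have "(\<Sum>\<gamma>\<in>G. (x \<bullet> \<phi> \<gamma>) *\<^sub>R \<phi> \<gamma>) = (\<Sum>\<gamma>\<in>G. if \<gamma> = \<delta> then x else 0)"
    using \<delta> assms inner_basis[of \<delta>] by (intro sum.cong) (auto simp: subset_iff)
  then show ?case using \<delta> assms by simp
qed

text \<open>
  Any \<open>y\<close> in the algebraic span close to \<open>x\<close> lives on finitely many basis vectors, and every
  larger finite partial sum approximates \<open>x\<close> at least as well as \<open>y\<close> does.
\<close>

lemma expansion: "((\<lambda>\<gamma>. (x \<bullet> \<phi> \<gamma>) *\<^sub>R \<phi> \<gamma>) has_sum x) \<Gamma>"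
  unfolding has_sum_def tendsto_iff
proof (intro allI impI)
  fix e :: real assume "e > 0"
  have "x \<in> closure (span (\<phi> ` \<Gamma>))" using basis by (simp add: orthonormal_basis_def)
  then obtain y where y: "y \<in> span (\<phi> ` \<Gamma>)" "dist y x < e"
    using \<open>e > 0\<close> by (meson closure_approachable)
  from y(1) obtain t r where t: "finite t" "t \<subseteq> \<phi> ` \<Gamma>" "y = (\<Sum>v\<in>t. r v *\<^sub>R v)"
    unfolding span_explicit by blast
  obtain F where F: "F \<subseteq> \<Gamma>" "finite F" "t = \<phi> ` F"
    using finite_subset_image[OF t(1,2)] by blast
  have "dist (\<Sum>\<gamma>\<in>G. (x \<bullet> \<phi> \<gamma>) *\<^sub>R \<phi> \<gamma>) x < e" if G: "finite G" "F \<subseteq> G" "G \<subseteq> \<Gamma>" for G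
  proof -
    have "y \<in> span (\<phi> ` G)" unfolding t(3)
      by (intro span_sum span_scale span_base) (use F G in auto)
    then have "y = (\<Sum>\<gamma>\<in>G. (y \<bullet> \<phi> \<gamma>) *\<^sub>R \<phi> \<gamma>)" using expansion_of_span G by metis
    then have eq: "x - (\<Sum>\<gamma>\<in>G. (x \<bullet> \<phi> \<gamma>) *\<^sub>R \<phi> \<gamma>)
        = (x - y) - (\<Sum>\<gamma>\<in>G. ((x - y) \<bullet> \<phi> \<gamma>) *\<^sub>R \<phi> \<gamma>)"
      by (simp add: inner_diff_left scaleR_diff_left sum_subtractf)
    then have "norm (x - (\<Sum>\<gamma>\<in>G. (x \<bullet> \<phi> \<gamma>) *\<^sub>R \<phi> \<gamma>)) \<le> norm (x - y)"
      using norm_projection_residual_le[OF G(1,3), of "x - y"] by (simp only: eq)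
    then show ?thesis using y(2) by (simp add: dist_norm norm_minus_commute)
  qed
  then show "\<forall>\<^sub>F G in finite_subsets_at_top \<Gamma>. dist (\<Sum>\<gamma>\<in>G. (x \<bullet> \<phi> \<gamma>) *\<^sub>R \<phi> \<gamma>) x < e"
    unfolding eventually_finite_subsets_at_top using F by blast
qed

lemma parseval: "((\<lambda>\<gamma>. (x \<bullet> \<phi> \<gamma>) * (y \<bullet> \<phi> \<gamma>)) has_sum (x \<bullet> y)) \<Gamma>"
  using has_sum_bounded_linear[OF bounded_linear_inner_left[of y] expansion[of x]]
  by (simp add: inner_commute[of y])

lemma parseval_norm: "((\<lambda>\<gamma>. (x \<bullet> \<phi> \<gamma>)\<^sup>2) has_sum (norm x)\<^sup>2) \<Gamma>"
  using parseval[of x x] by (simp add: power2_eq_square dot_square_norm)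

lemma eq_if_coefficients_eq:
  assumes "\<And>\<gamma>. \<gamma> \<in> \<Gamma> \<Longrightarrow> x \<bullet> \<phi> \<gamma> = y \<bullet> \<phi> \<gamma>"
  shows "x = y"
proof -
  have "((\<lambda>\<gamma>. (x \<bullet> \<phi> \<gamma>) *\<^sub>R \<phi> \<gamma>) has_sum y) \<Gamma>"
    using expansion[of y] by (rule has_sum_cong[THEN iffD1, rotated]) (use assms in auto)
  then show ?thesis using expansion has_sum_unique by blast
qed

text \<open>
  Completeness enters here: finite sets \<open>F n\<close> that exhaust the square sum up to \<open>1 / Suc n\<close> give
  partial sums \<open>v n\<close> which form a Cauchy sequence, even though \<open>\<Gamma>\<close> may be uncountable.
\<close>

lemma riesz_fischer:
  assumes "(\<lambda>\<gamma>. (a \<gamma>)\<^sup>2) summable_on \<Gamma>"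
  shows "\<exists>x. \<forall>\<gamma>\<in>\<Gamma>. x \<bullet> \<phi> \<gamma> = a \<gamma>"
proof -
  define S where "S = infsum (\<lambda>\<gamma>. (a \<gamma>)\<^sup>2) \<Gamma>"
  have hs: "((\<lambda>\<gamma>. (a \<gamma>)\<^sup>2) has_sum S) \<Gamma>" using assms by (simp add: S_def)
  have le: "sum (\<lambda>\<gamma>. (a \<gamma>)\<^sup>2) F \<le> S" if "finite F" "F \<subseteq> \<Gamma>" for F
    unfolding S_def using assms that by (intro finite_sum_le_infsum) auto
  have "\<exists>F. finite F \<and> F \<subseteq> \<Gamma> \<and> S - sum (\<lambda>\<gamma>. (a \<gamma>)\<^sup>2) F \<le> 1 / Suc n" for n :: nat
    using has_sum_finite_approximation[OF hs, of "1 / Suc n"] by (force simp: dist_real_def)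
  then obtain F where F: "\<And>n. finite (F n)" "\<And>n. F n \<subseteq> \<Gamma>"
      "\<And>n. S - sum (\<lambda>\<gamma>. (a \<gamma>)\<^sup>2) (F n) \<le> 1 / Suc n"
    by metis
  define v where "v = (\<lambda>n. \<Sum>\<gamma>\<in>F n. a \<gamma> *\<^sub>R \<phi> \<gamma>)"
  have near: "(norm (v n - (\<Sum>\<gamma>\<in>G. a \<gamma> *\<^sub>R \<phi> \<gamma>)))\<^sup>2 \<le> 1 / Suc n"
    if G: "finite G" "G \<subseteq> \<Gamma>" "F n \<subseteq> G" for n G
  proof -
    have "(\<Sum>\<gamma>\<in>G. a \<gamma> *\<^sub>R \<phi> \<gamma>) - v n = (\<Sum>\<gamma>\<in>G - F n. a \<gamma> *\<^sub>R \<phi> \<gamma>)"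
      unfolding v_def using G by (simp add: sum_diff)
    then have "(norm (v n - (\<Sum>\<gamma>\<in>G. a \<gamma> *\<^sub>R \<phi> \<gamma>)))\<^sup>2 = (\<Sum>\<gamma>\<in>G - F n. (a \<gamma>)\<^sup>2)"
      using norm_sum_basis[of "G - F n" a] G by (subst norm_minus_commute) auto
    also have "\<dots> = sum (\<lambda>\<gamma>. (a \<gamma>)\<^sup>2) G - sum (\<lambda>\<gamma>. (a \<gamma>)\<^sup>2) (F n)"
      using G by (simp add: sum_diff)
    also have "\<dots> \<le> 1 / Suc n" using le[OF G(1,2)] F(3)[of n] by linarith
    finally show ?thesis .
  qed
  have "Cauchy v" unfolding Cauchy_def
  proof (intro allI impI)
    fix e :: real assume e: "e > 0"
    then obtain N where N: "1 / Suc N < (e / 2)\<^sup>2"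
      by (metis half_gt_zero nat_approx_posE zero_less_power)
    have half: "norm (v n - (\<Sum>\<gamma>\<in>G. a \<gamma> *\<^sub>R \<phi> \<gamma>)) < e / 2"
      if "finite G" "G \<subseteq> \<Gamma>" "F n \<subseteq> G" "n \<ge> N" for n G
    proof (rule power2_less_imp_less)
      have "1 / real (Suc n) \<le> 1 / Suc N" using that by (simp add: frac_le)
      then show "(norm (v n - (\<Sum>\<gamma>\<in>G. a \<gamma> *\<^sub>R \<phi> \<gamma>)))\<^sup>2 < (e / 2)\<^sup>2"
        using near[OF that(1-3)] N by linarith
    qed (use e in simp)
    have "dist (v m) (v n) < e" if "m \<ge> N" "n \<ge> N" for m n
    proof -
      let ?G = "F m \<union> F n"
      have "norm (v m - (\<Sum>\<gamma>\<in>?G. a \<gamma> *\<^sub>R \<phi> \<gamma>)) < e / 2"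
        by (rule half) (use F that in auto)
      moreover have "norm (v n - (\<Sum>\<gamma>\<in>?G. a \<gamma> *\<^sub>R \<phi> \<gamma>)) < e / 2"
        by (rule half) (use F that in auto)
      ultimately show ?thesis unfolding dist_norm[symmetric] by (rule dist_triangle_half_l)
    qed
    then show "\<exists>N. \<forall>m\<ge>N. \<forall>n\<ge>N. dist (v m) (v n) < e" by blast
  qed
  then obtain x where x: "v \<longlonglongrightarrow> x" using Cauchy_convergent convergent_def by blast
  have "x \<bullet> \<phi> \<gamma> = a \<gamma>" if \<gamma>: "\<gamma> \<in> \<Gamma>" for \<gamma>
  proof (rule LIMSEQ_unique)
    show "(\<lambda>n. v n \<bullet> \<phi> \<gamma>) \<longlonglongrightarrow> x \<bullet> \<phi> \<gamma>" by (intro tendsto_intros x)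
    have "(a \<gamma> - v n \<bullet> \<phi> \<gamma>)\<^sup>2 \<le> 1 / Suc n" for n
    proof (cases "\<gamma> \<in> F n")
      case False
      have "(a \<gamma>)\<^sup>2 \<le> 1 / Suc n"
        using le[of "insert \<gamma> (F n)"] F(1)[of n] F(2)[of n] F(3)[of n] \<gamma> False by simp
      then show ?thesis using inner_sum_basis[OF F(1)[of n] F(2)[of n] \<gamma>, of a] False by (simp add: v_def)
    qed (use inner_sum_basis[OF F(1)[of n] F(2)[of n] \<gamma>, of a] in \<open>simp add: v_def\<close>)
    then have "(\<lambda>n. (a \<gamma> - v n \<bullet> \<phi> \<gamma>)\<^sup>2) \<longlonglongrightarrow> 0"
      by (intro tendsto_sandwich[OF _ _ tendsto_const LIMSEQ_Suc[OF lim_1_over_n]] always_eventually) auto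
    then have "(\<lambda>n. a \<gamma> - v n \<bullet> \<phi> \<gamma>) \<longlonglongrightarrow> 0"
      by (simp add: power_tendsto_0_iff)
    then show "(\<lambda>n. v n \<bullet> \<phi> \<gamma>) \<longlonglongrightarrow> a \<gamma>"
      using tendsto_diff[OF tendsto_const[of "a \<gamma>"], of "\<lambda>n. a \<gamma> - v n \<bullet> \<phi> \<gamma>" 0] by simp
  qed
  then show ?thesis by blast
qed

lemma infsum_coefficient:
  assumes "(\<lambda>\<gamma>. (a \<gamma>)\<^sup>2) summable_on \<Gamma>" "\<gamma> \<in> \<Gamma>"
  shows "(\<Sum>\<^sub>\<infinity>\<gamma>\<in>\<Gamma>. a \<gamma> *\<^sub>R \<phi> \<gamma>) \<bullet> \<phi> \<gamma> = a \<gamma>"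
proof -
  obtain x where x: "\<forall>\<gamma>\<in>\<Gamma>. x \<bullet> \<phi> \<gamma> = a \<gamma>" using riesz_fischer[OF assms(1)] by blast
  have "(\<Sum>\<^sub>\<infinity>\<gamma>\<in>\<Gamma>. a \<gamma> *\<^sub>R \<phi> \<gamma>) = (\<Sum>\<^sub>\<infinity>\<gamma>\<in>\<Gamma>. (x \<bullet> \<phi> \<gamma>) *\<^sub>R \<phi> \<gamma>)"
    by (rule infsum_cong) (use x in simp)
  also have "\<dots> = x" using expansion by (rule infsumI)
  finally show ?thesis using x assms(2) by simp
qed

text \<open>
  The adjoint is a choice of a function with this property, so one has to exist. The
  coefficients of the value at \<open>y\<close> must be \<open>K (\<phi> \<gamma>) \<bullet> y\<close>, and boundedness of \<open>K\<close> makes them square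
  summable, so \<open>riesz_fischer\<close> supplies that value.
\<close>

lemma inner_adjoint_right:
  fixes K :: "'a \<Rightarrow> 'b::real_inner"
  assumes "bounded_linear K"
  shows "K x \<bullet> y = x \<bullet> adjoint K y"
proof -
  interpret K: bounded_linear K by fact
  obtain B where B: "\<And>x. norm (K x) \<le> norm x * B" "B \<ge> 0" using K.nonneg_bounded by blast
  have "\<exists>z. \<forall>x. K x \<bullet> y = x \<bullet> z" for y
  proof -
    define a where "a \<gamma> = K (\<phi> \<gamma>) \<bullet> y" for \<gamma>
    have "sum (\<lambda>\<gamma>. (a \<gamma>)\<^sup>2) F \<le> (B * norm y)\<^sup>2" if F: "finite F" "F \<subseteq> \<Gamma>" for F
    proof -
      define u where "u = (\<Sum>\<gamma>\<in>F. a \<gamma> *\<^sub>R \<phi> \<gamma>)"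
      have u2: "(norm u)\<^sup>2 = sum (\<lambda>\<gamma>. (a \<gamma>)\<^sup>2) F" unfolding u_def by (rule norm_sum_basis[OF F])
      also have "\<dots> = K u \<bullet> y"
        by (simp add: u_def a_def K.sum K.scaleR inner_sum_left power2_eq_square)
      also have "\<dots> \<le> norm (K u) * norm y" by (rule norm_cauchy_schwarz)
      also have "\<dots> \<le> norm u * B * norm y" by (intro mult_right_mono B) auto
      finally have "norm u * norm u \<le> norm u * (B * norm y)"
        by (simp add: power2_eq_square mult.assoc)
      then have "norm u \<le> B * norm y"
        using B(2) by (cases "u = 0") (auto simp: mult_le_cancel_left_pos)
      then show ?thesis unfolding u2[symmetric] by (intro power_mono) auto
    qed
    then have "(\<lambda>\<gamma>. (a \<gamma>)\<^sup>2) summable_on \<Gamma>"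
      by (intro nonneg_bdd_above_summable_on bdd_aboveI2) auto
    then obtain z where z: "\<forall>\<gamma>\<in>\<Gamma>. z \<bullet> \<phi> \<gamma> = a \<gamma>" using riesz_fischer by blast
    have "K x \<bullet> y = x \<bullet> z" for x
    proof (rule has_sum_unique)
      have "((\<lambda>\<gamma>. K ((x \<bullet> \<phi> \<gamma>) *\<^sub>R \<phi> \<gamma>) \<bullet> y) has_sum K x \<bullet> y) \<Gamma>"
        by (intro has_sum_bounded_linear[OF bounded_linear_inner_left]
            has_sum_bounded_linear[OF assms] expansion)
      then show "((\<lambda>\<gamma>. (x \<bullet> \<phi> \<gamma>) * a \<gamma>) has_sum K x \<bullet> y) \<Gamma>"
        by (simp add: K.scaleR a_def)
      show "((\<lambda>\<gamma>. (x \<bullet> \<phi> \<gamma>) * a \<gamma>) has_sum x \<bullet> z) \<Gamma>"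
        using parseval[of x z] by (rule has_sum_cong[THEN iffD1, rotated]) (use z in auto)
    qed
    then show ?thesis by blast
  qed
  then obtain K' where "\<forall>y x. K x \<bullet> y = x \<bullet> K' y" by metis
  then have "\<exists>K'. \<forall>x y. K x \<bullet> y = x \<bullet> K' y" by blast
  then show ?thesis unfolding adjoint_def by (rule someI2_ex) blast
qed

lemma abs_coefficient_le:
  assumes "\<gamma> \<in> \<Gamma>" shows "\<bar>f \<bullet> \<phi> \<gamma>\<bar> \<le> norm f"
  using Cauchy_Schwarz_ineq2[of f "\<phi> \<gamma>"] basis assms by (simp add: orthonormal_basis_def)

text \<open>
  A finite set that captures the square sum up to \<open>e\<^sup>2\<close> leaves no room for a further coefficient
  exceeding \<open>e\<close>.
\<close>

lemma finitely_many_large_coefficients: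
  assumes "e > 0"
  shows "\<exists>F. finite F \<and> F \<subseteq> \<Gamma> \<and> (\<forall>\<gamma>\<in>\<Gamma> - F. \<bar>u \<bullet> \<phi> \<gamma>\<bar> \<le> e)"
proof -
  obtain F where F: "finite F" "F \<subseteq> \<Gamma>" "dist (\<Sum>\<gamma>\<in>F. (u \<bullet> \<phi> \<gamma>)\<^sup>2) ((norm u)\<^sup>2) \<le> e\<^sup>2"
    using has_sum_finite_approximation[OF parseval_norm[of u], of "e\<^sup>2"] assms by auto
  have "\<bar>u \<bullet> \<phi> \<gamma>\<bar> \<le> e" if \<gamma>: "\<gamma> \<in> \<Gamma> - F" for \<gamma>
  proof -
    have "(\<Sum>\<gamma>\<in>insert \<gamma> F. (u \<bullet> \<phi> \<gamma>)\<^sup>2) \<le> (norm u)\<^sup>2"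
      by (rule finite_sum_le_has_sum[OF parseval_norm]) (use F \<gamma> in auto)
    then have "(u \<bullet> \<phi> \<gamma>)\<^sup>2 \<le> e\<^sup>2" using F \<gamma> by (simp add: dist_real_def)
    then show ?thesis using assms by (metis abs_le_square_iff abs_of_pos)
  qed
  then show ?thesis using F by blast
qed

end

section \<open>Scalar shrinkage\<close>

text \<open>
  Surjectivity alone makes \<open>inv\<close> a right inverse, and this is the form in which the definition
  of the shrinkage function for \<open>p > 1\<close> enters the later arguments.
\<close>

lemma surj_shrink_inverse:
  fixes w p :: real
  assumes "w \<ge> 0" "p > 1"
  shows "surj (shrink_inverse w p)"
proof -
  have pos: "\<exists>y. shrink_inverse w p y = x" if x: "x \<ge> 0" for x
  proof -
    define F where "F y = y + w * p / 2 * y powr (p - 1)" for y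
    have "\<exists>y. 0 \<le> y \<and> y \<le> x \<and> F y = x"
    proof (rule IVT')
      show "F 0 \<le> x" "x \<le> F x" using assms x by (auto simp: F_def)
      show "continuous_on {0..x} F" unfolding F_def
        using assms by (intro continuous_on_powr' continuous_intros) auto
    qed (use x in simp)
    then obtain y where y: "0 \<le> y" "F y = x" by blast
    then have "shrink_inverse w p y = x"
      using assms by (cases "y = 0") (auto simp: F_def shrink_inverse_def)
    then show ?thesis by blast
  qed
  have "\<exists>y. shrink_inverse w p y = x" for x
  proof (cases "x \<ge> 0")
    case False
    then obtain y where "shrink_inverse w p y = - x" using pos[of "- x"] by auto
    then have "shrink_inverse w p (- y) = x" by (simp add: shrink_inverse_def sgn_minus)
    then show ?thesis by blast
  qed (rule pos)
  then show ?thesis unfolding surj_def by metis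
qed

lemma shrink_equation:
  assumes "w \<ge> 0" "p > 1"
  shows "h - shrink w p h = w * p / 2 * (sgn (shrink w p h) * \<bar>shrink w p h\<bar> powr (p - 1))"
proof -
  have "shrink_inverse w p (shrink w p h) = h"
    using surj_f_inv_f[OF surj_shrink_inverse[OF assms]] assms by (simp add: shrink_def)
  then show ?thesis by (simp add: shrink_inverse_def)
qed

text \<open>
  The convexity of \<open>\<bar>\<cdot>\<bar> powr p\<close>, stated as the tangent at \<open>s\<close> lying below the graph. After
  multiplying out it is Young's inequality for \<open>\<bar>t\<bar>\<close> and \<open>\<bar>s\<bar> powr (p - 1)\<close>.
\<close>

lemma powr_gradient_inequality:
  fixes p s t :: real
  assumes "p > 1"
  shows "\<bar>s\<bar> powr p + p * (sgn s * \<bar>s\<bar> powr (p - 1)) * (t - s) \<le> \<bar>t\<bar> powr p"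
proof -
  have ss: "sgn s * \<bar>s\<bar> powr (p - 1) * s = \<bar>s\<bar> powr p"
  proof (cases "s = 0")
    case False
    have "sgn s * \<bar>s\<bar> powr (p - 1) * s = \<bar>s\<bar> * \<bar>s\<bar> powr (p - 1)"
      by (simp add: abs_sgn mult_ac)
    also have "\<dots> = \<bar>s\<bar> powr p" using False by (simp add: powr_mult_base)
    finally show ?thesis .
  qed simp
  have "sgn s * \<bar>s\<bar> powr (p - 1) * t \<le> \<bar>s\<bar> powr (p - 1) * \<bar>t\<bar>"
    by (cases "s = 0"; cases "s > 0") (auto intro!: mult_left_mono simp: sgn_if abs_real_def mult_nonneg_nonpos)
  also have "\<dots> \<le> \<bar>t\<bar> powr p / p + (\<bar>s\<bar> powr (p - 1)) powr (p / (p - 1)) / (p / (p - 1))"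
    using Youngs_inequality[of p "p / (p - 1)" "\<bar>t\<bar>" "\<bar>s\<bar> powr (p - 1)"] assms
    by (auto simp: field_simps)
  also have "(\<bar>s\<bar> powr (p - 1)) powr (p / (p - 1)) = \<bar>s\<bar> powr p"
    using assms by (simp add: powr_powr)
  finally have "p * (sgn s * \<bar>s\<bar> powr (p - 1) * t) \<le> p * (\<bar>t\<bar> powr p / p + \<bar>s\<bar> powr p / (p / (p - 1)))"
    using assms by (intro mult_left_mono) auto
  also have "\<dots> = \<bar>t\<bar> powr p + (p - 1) * \<bar>s\<bar> powr p"
    using assms by (simp add: field_simps)
  finally have "p * (sgn s * \<bar>s\<bar> powr (p - 1) * t) \<le> \<bar>t\<bar> powr p + (p - 1) * \<bar>s\<bar> powr p" .
  then show ?thesis using ss by (simp add: algebra_simps)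
qed

text \<open>
  The optimality condition for minimizing \<open>(s - h)\<^sup>2 + w \<bar>s\<bar> powr p\<close> over \<open>s\<close>. For \<open>p > 1\<close> the number
  \<open>2 (h - s)\<close> is the derivative of the penalty; for \<open>p = 1\<close> it equals \<open>w\<close> or \<open>- w\<close>, or lies
  between them when \<open>s = 0\<close>.
\<close>

lemma shrink_subgradient:
  assumes "w \<ge> 0" "p \<ge> 1"
  shows "w * \<bar>shrink w p h\<bar> powr p + 2 * (h - shrink w p h) * (t - shrink w p h) \<le> w * \<bar>t\<bar> powr p"
proof (cases "p = 1")
  case False
  define s where "s = shrink w p h"
  have p: "p > 1" using assms False by simp
  have "w * (\<bar>s\<bar> powr p + p * (sgn s * \<bar>s\<bar> powr (p - 1)) * (t - s)) \<le> w * \<bar>t\<bar> powr p"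
    using assms by (intro mult_left_mono powr_gradient_inequality p)
  then show ?thesis
    using shrink_equation[OF assms(1) p, of h] unfolding s_def[symmetric]
    by (simp add: algebra_simps)
next
  case True
  consider "h \<ge> w / 2" | "\<bar>h\<bar> < w / 2" | "h \<le> - w / 2" "\<not> h \<ge> w / 2" by linarith
  then show ?thesis
  proof cases
    case 1
    then have "shrink w p h = h - w / 2" using True by (simp add: shrink_def)
    moreover have "w * t \<le> w * \<bar>t\<bar>" using assms by (intro mult_left_mono) auto
    ultimately show ?thesis using 1 True by (simp add: left_diff_distrib right_diff_distrib)
  next
    case 2
    then have "shrink w p h = 0" using True by (auto simp: shrink_def)
    moreover have "2 * h * t \<le> w * \<bar>t\<bar>"
    proof -
      have "2 * h * t \<le> \<bar>2 * h\<bar> * \<bar>t\<bar>" by (metis abs_ge_self abs_mult)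
      also have "\<dots> \<le> w * \<bar>t\<bar>" using 2 by (intro mult_right_mono) auto
      finally show ?thesis .
    qed
    ultimately show ?thesis using 2 True by simp
  next
    case 3
    then have "shrink w p h = h + w / 2" using True by (auto simp: shrink_def)
    moreover have "w * (- t) \<le> w * \<bar>t\<bar>" using assms by (intro mult_left_mono) auto
    ultimately show ?thesis using 3 True by (simp add: algebra_simps)
  qed
qed

text \<open>
  Comparison of the minimizer with \<open>t = 0\<close>. It shows that shrinkage maps square summable
  coefficients to square summable ones, and that the result has finite penalty.
\<close>

lemma shrink_energy:
  assumes "w \<ge> 0" "p \<ge> 1"
  shows "w * \<bar>shrink w p h\<bar> powr p + (shrink w p h)\<^sup>2 \<le> h\<^sup>2"
proof -
  define s where "s = shrink w p h"
  have "w * \<bar>s\<bar> powr p + 2 * s\<^sup>2 \<le> 2 * h * s"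
    using shrink_subgradient[OF assms, of h 0] by (simp add: s_def power2_eq_square algebra_simps)
  moreover have "2 * h * s \<le> h\<^sup>2 + s\<^sup>2" by (rule sum_squares_bound)
  ultimately show ?thesis unfolding s_def[symmetric] by linarith
qed

text \<open>
  Since \<open>p - 2 \<le> 0\<close>, the derivative of \<open>z powr (p - 1)\<close> on \<open>(0, M)\<close> is at
  least its value at \<open>M\<close>.
\<close>

lemma powr_linear_lower_growth:
  fixes p M x y :: real
  assumes "1 < p" "p \<le> 2" "0 \<le> x" "x \<le> y" "y \<le> M" "M > 0"
  shows "(p - 1) * M powr (p - 2) * (y - x) \<le> y powr (p - 1) - x powr (p - 1)"
proof -
  define m where "m = (p - 1) * M powr (p - 2)"
  have "x powr (p - 1) - m * x \<le> y powr (p - 1) - m * y"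
  proof (rule DERIV_nonneg_imp_increasing_open[OF assms(4)])
    fix z assume z: "x < z" "z < y"
    have "((\<lambda>z. z powr (p - 1) - m * z) has_real_derivative (p - 1) * z powr (p - 1 - 1) - m) (at z)"
      using z assms by (auto intro!: derivative_eq_intros)
    moreover have "M powr (p - 2) \<le> z powr (p - 2)"
      using z assms by (intro powr_mono2') auto
    then have "(p - 1) * z powr (p - 1 - 1) - m \<ge> 0"
      unfolding m_def using assms by (simp add: mult_left_mono)
    ultimately show "\<exists>d. ((\<lambda>z. z powr (p - 1) - m * z) has_real_derivative d) (at z) \<and> 0 \<le> d"
      by blast
  next
    show "continuous_on {x..y} (\<lambda>z. z powr (p - 1) - m * z)"
      using assms by (intro continuous_on_powr' continuous_intros) auto
  qed
  then show ?thesis unfolding m_def[symmetric] by (simp add: algebra_simps)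
qed

lemma signed_powr_strongly_monotone:
  fixes p M a b :: real
  assumes "1 < p" "p \<le> 2" "\<bar>a\<bar> \<le> M" "\<bar>b\<bar> \<le> M" "M > 0"
  shows "(p - 1) * M powr (p - 2) * (a - b)\<^sup>2
     \<le> (sgn a * \<bar>a\<bar> powr (p - 1) - sgn b * \<bar>b\<bar> powr (p - 1)) * (a - b)"
proof -
  define m \<sigma> where "m = (p - 1) * M powr (p - 2)" and "\<sigma> x = sgn x * \<bar>x\<bar> powr (p - 1)" for x :: real
  have odd: "\<sigma> (- x) = - \<sigma> x" for x by (simp add: \<sigma>_def sgn_minus)
  have pos: "m * (y - x) \<le> \<sigma> y - \<sigma> x" if "0 \<le> x" "x \<le> y" "y \<le> M" for x y
    using powr_linear_lower_growth[OF assms(1,2) that assms(5)] that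
    by (auto simp: m_def \<sigma>_def sgn_if)
  have mono: "m * (y - x) \<le> \<sigma> y - \<sigma> x" if "x \<le> y" "\<bar>x\<bar> \<le> M" "\<bar>y\<bar> \<le> M" for x y
  proof -
    consider "0 \<le> x" | "y \<le> 0" | "x \<le> 0" "0 \<le> y" by linarith
    then show ?thesis
    proof cases
      case 1 then show ?thesis using pos that by auto
    next
      case 2 then show ?thesis using pos[of "- y" "- x"] that odd by auto
    next
      case 3
      have "\<sigma> 0 = 0" by (simp add: \<sigma>_def)
      with 3 show ?thesis using pos[of 0 "- x"] pos[of 0 y] that odd[of x] by (auto simp: algebra_simps)
    qed
  qed
  have "m * (a - b)\<^sup>2 \<le> (\<sigma> a - \<sigma> b) * (a - b)"
  proof (cases "b \<le> a")
    case True
    then have "(m * (a - b)) * (a - b) \<le> (\<sigma> a - \<sigma> b) * (a - b)"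
      using mono[of b a] assms by (intro mult_right_mono) auto
    then show ?thesis by (simp add: power2_eq_square mult.assoc)
  next
    case False
    then have "(m * (b - a)) * (b - a) \<le> (\<sigma> b - \<sigma> a) * (b - a)"
      using mono[of a b] assms by (intro mult_right_mono) auto
    then show ?thesis by (simp add: power2_eq_square algebra_simps)
  qed
  then show ?thesis unfolding m_def \<sigma>_def .
qed

text \<open>
  With \<open>M\<close> bounding the shrunk values, shrinkage is a contraction with factor
  \<open>1 / (1 + c p (p - 1) / 2 * M powr (p - 2))\<close>, uniformly in all weights \<open>w \<ge> c\<close>. At \<open>p = 1\<close> the
  extra term vanishes and this is the firm nonexpansiveness of a proximal map, which follows by
  adding the two subgradient inequalities.
\<close>

lemma shrink_strongly_nonexpansive:
  fixes w p c M h h' :: real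
  defines "s \<equiv> shrink w p h" and "s' \<equiv> shrink w p h'"
  assumes "1 \<le> p" "p \<le> 2" "0 < c" "c \<le> w" "0 < M" "\<bar>s\<bar> \<le> M" "\<bar>s'\<bar> \<le> M"
  shows "(1 + c * p * (p - 1) / 2 * M powr (p - 2)) * (s - s')\<^sup>2 \<le> (s - s') * (h - h')"
proof (cases "p = 1")
  case True
  have "w * \<bar>s\<bar> powr p + 2 * (h - s) * (s' - s) \<le> w * \<bar>s'\<bar> powr p"
    and "w * \<bar>s'\<bar> powr p + 2 * (h' - s') * (s - s') \<le> w * \<bar>s\<bar> powr p"
    using shrink_subgradient[of w p h s'] shrink_subgradient[of w p h' s] assms by simp_all
  then have "2 * (h - s) * (s' - s) + 2 * (h' - s') * (s - s') \<le> 0" by linarith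
  then show ?thesis using True by (simp add: power2_eq_square algebra_simps)
next
  case False
  then have p: "p > 1" using assms by simp
  define \<sigma> where "\<sigma> x = sgn x * \<bar>x\<bar> powr (p - 1)" for x :: real
  define D where "D = (\<sigma> s - \<sigma> s') * (s - s')"
  have D: "(p - 1) * M powr (p - 2) * (s - s')\<^sup>2 \<le> D"
    unfolding D_def \<sigma>_def using assms p by (intro signed_powr_strongly_monotone) auto
  have eqs: "h - s = w * p / 2 * \<sigma> s" "h' - s' = w * p / 2 * \<sigma> s'"
    unfolding s_def s'_def \<sigma>_def using assms(5,6) p by (intro shrink_equation; simp)+
  have "(s - s') * (h - h') = (s - s')\<^sup>2 + (s - s') * ((h - s) - (h' - s'))"
    by (simp add: power2_eq_square algebra_simps)
  also have "\<dots> = (s - s')\<^sup>2 + w * p / 2 * D" unfolding eqs D_def by (simp add: field_simps)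
  finally have eq: "(s - s') * (h - h') = (s - s')\<^sup>2 + w * p / 2 * D" .
  have "0 \<le> (p - 1) * M powr (p - 2) * (s - s')\<^sup>2" using p by simp
  then have "D \<ge> 0" using D by linarith
  have "c * p / 2 * ((p - 1) * M powr (p - 2) * (s - s')\<^sup>2) \<le> c * p / 2 * D"
    using D assms by (intro mult_left_mono) auto
  also have "\<dots> \<le> w * p / 2 * D"
    using \<open>D \<ge> 0\<close> assms by (intro mult_right_mono) auto
  finally show ?thesis unfolding eq by (simp add: algebra_simps)
qed

lemma soft_threshold_bound:
  assumes "w > 0"
  shows "\<bar>shrink w 1 x\<bar> \<le> max 0 (\<bar>x\<bar> - w / 2)"
  using assms by (auto simp: shrink_def)

section \<open>The objective and the shrinkage step\<close>

text \<open>
  Besides the extended-valued functional, the arguments in this locale use the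
  real-valued \<open>objective\<close>; it agrees with the functional where the predicate
  \<open>finite_penalty\<close> holds, and there differences of values can be formed.
\<close>

locale thresholded_landweber = orthonormal_basis_on \<Gamma> \<phi>
  for \<Gamma> :: "'i set" and \<phi> :: "'i \<Rightarrow> 'a::{real_inner, complete_space}" +
  fixes K :: "'a \<Rightarrow> 'b::{real_inner, complete_space}"
    and g :: 'b
    and w :: "'i \<Rightarrow> real"
    and p c :: real
  assumes linear_K: "bounded_linear K"
    and onorm_K: "onorm K < 1"
    and p_ge_1: "1 \<le> p" and p_le_2: "p \<le> 2"
    and c_pos: "c > 0"
    and weight_ge: "\<gamma> \<in> \<Gamma> \<Longrightarrow> c \<le> w \<gamma>"
begin

sublocale K: bounded_linear K by (rule linear_K)

definition finite_penalty :: "'a \<Rightarrow> bool" where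
  "finite_penalty f \<longleftrightarrow> (\<lambda>\<gamma>. w \<gamma> * \<bar>f \<bullet> \<phi> \<gamma>\<bar> powr p) summable_on \<Gamma>"

definition penalty :: "'a \<Rightarrow> real" where
  "penalty f = (\<Sum>\<^sub>\<infinity>\<gamma>\<in>\<Gamma>. w \<gamma> * \<bar>f \<bullet> \<phi> \<gamma>\<bar> powr p)"

definition objective :: "'a \<Rightarrow> real" where
  "objective f = (norm (K f - g))\<^sup>2 + penalty f"

definition step :: "'a \<Rightarrow> 'a" where
  "step f = shrinkage \<Gamma> \<phi> w p (f + adjoint K (g - K f))"

lemma weight_pos: "\<gamma> \<in> \<Gamma> \<Longrightarrow> w \<gamma> > 0"
  using weight_ge c_pos by force

lemma penalty_has_sum:
  "finite_penalty f \<Longrightarrow> ((\<lambda>\<gamma>. w \<gamma> * \<bar>f \<bullet> \<phi> \<gamma>\<bar> powr p) has_sum penalty f) \<Gamma>"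
  by (simp add: finite_penalty_def penalty_def)

lemma penalty_nonneg: "penalty f \<ge> 0"
  unfolding penalty_def by (intro infsum_nonneg) (use weight_pos in \<open>auto simp: less_imp_le\<close>)

lemma objective_nonneg: "objective f \<ge> 0"
  by (simp add: objective_def penalty_nonneg)

lemma finite_penalty_0: "finite_penalty 0"
  by (simp add: finite_penalty_def)

text \<open>
  The powers \<open>1 / p\<close> and \<open>p\<close> cancel, on \<open>\<infinity>\<close> as well. A finite sum in \<^typ>\<open>ennreal\<close> bounds
  all finite partial sums and therefore means real summability.
\<close>

lemma penalized_functional_eq:
  "penalized_functional K g \<Gamma> \<phi> w p f = (if finite_penalty f then ennreal (objective f) else \<infinity>)"
proof -
  define t where "t \<gamma> = w \<gamma> * \<bar>f \<bullet> \<phi> \<gamma>\<bar> powr p" for \<gamma>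
  have t0: "t \<gamma> \<ge> 0" if "\<gamma> \<in> \<Gamma>" for \<gamma> using weight_pos[OF that] by (simp add: t_def)
  define X where "X = (\<Sum>\<^sub>\<infinity>\<gamma>\<in>\<Gamma>. ennreal (t \<gamma>))"
  have X: "X = (SUP F\<in>{F. finite F \<and> F \<subseteq> \<Gamma>}. ennreal (sum t F))"
    unfolding X_def by (subst nonneg_infsum_complete) (auto intro!: SUP_cong sum_ennreal t0)
  have roots: "ennreal_powr (ennreal_powr X (1 / p)) p = X"
    using p_ge_1 by (cases "X = \<infinity>") (auto simp: ennreal_powr_def powr_powr less_top)
  have Phi: "penalized_functional K g \<Gamma> \<phi> w p f = ennreal ((norm (K f - g))\<^sup>2) + X"
    unfolding penalized_functional_def weighted_norm_def
    unfolding t_def[symmetric] X_def[symmetric] roots ..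
  show ?thesis
  proof (cases "finite_penalty f")
    case True
    then have "t summable_on \<Gamma>" by (simp add: finite_penalty_def t_def[abs_def])
    then have "X = ennreal (penalty f)"
      using infsum_nonneg_is_SUPREMUM_ennreal[of t \<Gamma>] t0 unfolding X penalty_def t_def[abs_def] by simp
    then show ?thesis using True penalty_nonneg by (simp add: Phi objective_def ennreal_plus)
  next
    case False
    have "X = \<infinity>"
    proof (rule ccontr)
      assume "X \<noteq> \<infinity>"
      then obtain r where r: "r \<ge> 0" "X = ennreal r" by (cases X) auto
      have "sum t F \<le> r" if "finite F" "F \<subseteq> \<Gamma>" for F
      proof -
        have "ennreal (sum t F) \<le> X" unfolding X by (rule SUP_upper) (use that in auto)
        then show ?thesis using r by simp
      qed
      then have "t summable_on \<Gamma>"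
        by (intro nonneg_bdd_above_summable_on t0 bdd_aboveI2) auto
      then show False using False by (simp add: finite_penalty_def t_def[abs_def])
    qed
    then show ?thesis using False by (simp add: Phi)
  qed
qed

lemma is_minimizer_iff:
  "is_minimizer (penalized_functional K g \<Gamma> \<phi> w p) f \<longleftrightarrow>
     finite_penalty f \<and> (\<forall>z. finite_penalty z \<longrightarrow> objective f \<le> objective z)"
proof
  assume min: "is_minimizer (penalized_functional K g \<Gamma> \<phi> w p) f"
  have "finite_penalty f"
  proof (rule ccontr)
    assume "\<not> finite_penalty f"
    then show False using min finite_penalty_0
      unfolding is_minimizer_def penalized_functional_eq by (auto dest!: spec[of _ 0] simp: top_unique)
  qed
  then show "finite_penalty f \<and> (\<forall>z. finite_penalty z \<longrightarrow> objective f \<le> objective z)"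
    using min objective_nonneg
    by (auto simp: is_minimizer_def penalized_functional_eq ennreal_le_iff split: if_splits)
qed (auto simp: is_minimizer_def penalized_functional_eq ennreal_leI)

lemma inner_adjoint: "x \<bullet> adjoint K y = K x \<bullet> y"
  using inner_adjoint_right[OF linear_K] by simp

lemma norm_K_le: "norm (K x) \<le> norm x"
proof -
  have "norm (K x) \<le> onorm K * norm x" by (rule onorm[OF linear_K])
  also have "\<dots> \<le> 1 * norm x" using onorm_K by (intro mult_right_mono) auto
  finally show ?thesis by simp
qed

lemma adjoint_diff: "adjoint K (y - z) = adjoint K y - adjoint K z"
  by (rule vector_eq_ldot[THEN iffD1]) (simp add: inner_adjoint inner_diff_right)

lemma norm_adjoint_le: "norm (adjoint K y) \<le> norm y"
proof -
  have "norm (adjoint K y) * norm (adjoint K y) = K (adjoint K y) \<bullet> y"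
    by (simp add: inner_adjoint[symmetric] dot_square_norm power2_eq_square)
  also have "\<dots> \<le> norm (K (adjoint K y)) * norm y" by (rule norm_cauchy_schwarz)
  also have "\<dots> \<le> norm (adjoint K y) * norm y" by (intro mult_right_mono norm_K_le) auto
  finally show ?thesis
    by (cases "adjoint K y = 0") (auto simp: mult_le_cancel_left_pos)
qed

text \<open>
  Expanding the square leaves \<open>\<parallel>b\<parallel>\<^sup>2 - 2 \<parallel>K b\<parallel>\<^sup>2 + \<parallel>K\<^sup>* K b\<parallel>\<^sup>2\<close>, and the last term is at most
  \<open>\<parallel>K b\<parallel>\<^sup>2\<close>.
\<close>

lemma norm_gradient_step_le: "norm (b - adjoint K (K b)) \<le> norm b"
proof (rule power2_le_imp_le)
  have "(norm (b - adjoint K (K b)))\<^sup>2 = (norm b)\<^sup>2 - 2 * (norm (K b))\<^sup>2 + (norm (adjoint K (K b)))\<^sup>2"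
    unfolding power2_norm_eq_inner inner_adjoint[symmetric]
    by (simp add: inner_diff_left inner_diff_right inner_commute)
  also have "(norm (adjoint K (K b)))\<^sup>2 \<le> (norm (K b))\<^sup>2"
    by (intro power_mono norm_adjoint_le) auto
  also have "(norm b)\<^sup>2 - 2 * (norm (K b))\<^sup>2 + (norm (K b))\<^sup>2 \<le> (norm b)\<^sup>2" by simp
  finally show "(norm (b - adjoint K (K b)))\<^sup>2 \<le> (norm b)\<^sup>2" by simp
qed simp

lemma shrink_coefficient_bounds:
  assumes "\<gamma> \<in> \<Gamma>"
  shows "w \<gamma> * \<bar>shrink (w \<gamma>) p h\<bar> powr p \<le> h\<^sup>2" "(shrink (w \<gamma>) p h)\<^sup>2 \<le> h\<^sup>2"
proof -
  have w: "w \<gamma> \<ge> 0" using weight_pos[OF assms] by simp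
  have "0 \<le> w \<gamma> * \<bar>shrink (w \<gamma>) p h\<bar> powr p" using w by simp
  then show "w \<gamma> * \<bar>shrink (w \<gamma>) p h\<bar> powr p \<le> h\<^sup>2" "(shrink (w \<gamma>) p h)\<^sup>2 \<le> h\<^sup>2"
    using shrink_energy[OF w p_ge_1, of h] zero_le_power2[of "shrink (w \<gamma>) p h"] by linarith+
qed

lemma shrinkage_coefficient:
  assumes "\<gamma> \<in> \<Gamma>"
  shows "shrinkage \<Gamma> \<phi> w p h \<bullet> \<phi> \<gamma> = shrink (w \<gamma>) p (h \<bullet> \<phi> \<gamma>)"
  unfolding shrinkage_def
proof (rule infsum_coefficient[OF _ assms])
  have "(\<lambda>\<gamma>. (h \<bullet> \<phi> \<gamma>)\<^sup>2) summable_on \<Gamma>" using parseval_norm has_sum_imp_summable by blast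
  then show "(\<lambda>\<gamma>. (shrink (w \<gamma>) p (h \<bullet> \<phi> \<gamma>))\<^sup>2) summable_on \<Gamma>"
    by (rule summable_on_comparison_test) (auto simp: shrink_coefficient_bounds)
qed

lemma finite_penalty_shrinkage: "finite_penalty (shrinkage \<Gamma> \<phi> w p h)"
  unfolding finite_penalty_def
proof (rule summable_on_comparison_test)
  show "(\<lambda>\<gamma>. (h \<bullet> \<phi> \<gamma>)\<^sup>2) summable_on \<Gamma>" using parseval_norm has_sum_imp_summable by blast
qed (auto simp: shrinkage_coefficient shrink_coefficient_bounds weight_pos less_imp_le)

text \<open>
  Shrinkage minimizes \<open>\<parallel>s - h\<parallel>\<^sup>2 + penalty s\<close>. The term \<open>\<parallel>z - s\<parallel>\<^sup>2\<close> quantifies how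
  much worse any competitor \<open>z\<close> is, by the strong convexity of the quadratic part.
\<close>

lemma shrinkage_proximal:
  fixes h :: 'a
  assumes "finite_penalty z"
  defines "s \<equiv> shrinkage \<Gamma> \<phi> w p h"
  shows "(norm (s - h))\<^sup>2 + penalty s + (norm (z - s))\<^sup>2 \<le> (norm (z - h))\<^sup>2 + penalty z"
proof (rule has_sum_mono)
  show "((\<lambda>\<gamma>. ((s - h) \<bullet> \<phi> \<gamma>)\<^sup>2 + w \<gamma> * \<bar>s \<bullet> \<phi> \<gamma>\<bar> powr p + ((z - s) \<bullet> \<phi> \<gamma>)\<^sup>2)
      has_sum (norm (s - h))\<^sup>2 + penalty s + (norm (z - s))\<^sup>2) \<Gamma>"
    unfolding s_def by (intro has_sum_add parseval_norm penalty_has_sum finite_penalty_shrinkage)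
  show "((\<lambda>\<gamma>. ((z - h) \<bullet> \<phi> \<gamma>)\<^sup>2 + w \<gamma> * \<bar>z \<bullet> \<phi> \<gamma>\<bar> powr p)
      has_sum (norm (z - h))\<^sup>2 + penalty z) \<Gamma>"
    by (intro has_sum_add parseval_norm penalty_has_sum assms)
  fix \<gamma> assume \<gamma>: "\<gamma> \<in> \<Gamma>"
  have "s \<bullet> \<phi> \<gamma> = shrink (w \<gamma>) p (h \<bullet> \<phi> \<gamma>)" unfolding s_def by (rule shrinkage_coefficient[OF \<gamma>])
  then have "w \<gamma> * \<bar>s \<bullet> \<phi> \<gamma>\<bar> powr p + 2 * (h \<bullet> \<phi> \<gamma> - s \<bullet> \<phi> \<gamma>) * (z \<bullet> \<phi> \<gamma> - s \<bullet> \<phi> \<gamma>)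
      \<le> w \<gamma> * \<bar>z \<bullet> \<phi> \<gamma>\<bar> powr p"
    using shrink_subgradient[of "w \<gamma>" p "h \<bullet> \<phi> \<gamma>" "z \<bullet> \<phi> \<gamma>"] weight_pos[OF \<gamma>] p_ge_1 by simp
  then show "((s - h) \<bullet> \<phi> \<gamma>)\<^sup>2 + w \<gamma> * \<bar>s \<bullet> \<phi> \<gamma>\<bar> powr p + ((z - s) \<bullet> \<phi> \<gamma>)\<^sup>2
      \<le> ((z - h) \<bullet> \<phi> \<gamma>)\<^sup>2 + w \<gamma> * \<bar>z \<bullet> \<phi> \<gamma>\<bar> powr p"
    unfolding inner_diff_left by (simp add: power2_eq_square algebra_simps)
qed

lemma finite_penalty_step: "finite_penalty (step f)"
  unfolding step_def by (rule finite_penalty_shrinkage)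

text \<open>
  Minimizing the distance to \<open>f + K\<^sup>* (g - K f)\<close> amounts to minimizing the misfit
  \<open>\<parallel>K z - g\<parallel>\<^sup>2\<close> with \<open>\<parallel>z - f\<parallel>\<^sup>2 - \<parallel>K (z - f)\<parallel>\<^sup>2 \<ge> 0\<close> added: the final bracket does not depend on \<open>z\<close>,
  so it cancels when two choices of \<open>z\<close> are compared.
\<close>

lemma linearized_misfit:
  "(norm (z - (f + adjoint K (g - K f))))\<^sup>2
     = (norm (z - f))\<^sup>2 - (norm (K (z - f)))\<^sup>2 + (norm (K z - g))\<^sup>2
       + ((norm (adjoint K (g - K f)))\<^sup>2 - (norm (K f - g))\<^sup>2)"
proof -
  define v where "v = adjoint K (g - K f)"
  have 1: "(norm (z - (f + v)))\<^sup>2 = (norm (z - f))\<^sup>2 - 2 * ((z - f) \<bullet> v) + (norm v)\<^sup>2"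
    unfolding power2_norm_eq_inner
    by (simp add: inner_diff_left inner_diff_right inner_add_left inner_add_right inner_commute)
  have 2: "(z - f) \<bullet> v = K (z - f) \<bullet> (g - K f)" unfolding v_def by (rule inner_adjoint)
  have Kz: "K z - g = K (z - f) - (g - K f)" by (simp add: K.diff)
  have 3: "(norm (K z - g))\<^sup>2
      = (norm (K (z - f)))\<^sup>2 - 2 * (K (z - f) \<bullet> (g - K f)) + (norm (K f - g))\<^sup>2"
    unfolding Kz power2_norm_eq_inner
    by (simp add: inner_diff_left inner_diff_right inner_commute)
  show ?thesis unfolding v_def[symmetric] using 1 2 3 by linarith
qed

lemma step_inequality:
  assumes "finite_penalty z"
  shows "objective (step f) + (norm (step f - f))\<^sup>2 - (norm (K (step f - f)))\<^sup>2
      + (norm (z - step f))\<^sup>2 + (norm (K (z - f)))\<^sup>2 \<le> objective z + (norm (z - f))\<^sup>2"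
  using shrinkage_proximal[OF assms, of "f + adjoint K (g - K f)"]
  unfolding step_def[symmetric] linearized_misfit objective_def by linarith

lemma step_decreases_distance:
  assumes "finite_penalty z"
  shows "objective (step f) + (norm (z - step f))\<^sup>2 \<le> objective z + (norm (z - f))\<^sup>2"
  using step_inequality[OF assms, of f] power_mono[OF norm_K_le[of "step f - f"] norm_ge_zero, of 2]
    zero_le_power2[of "norm (K (z - f))"] by linarith

lemma step_decreases_objective:
  assumes "finite_penalty f"
  shows "objective (step f) + (norm (step f - f))\<^sup>2 \<le> objective f"
  using step_decreases_distance[OF assms, of f] by (simp add: norm_minus_commute)

text \<open>
  A minimizer cannot be moved since a move by \<open>d\<close> lowers the objective by at least \<open>\<parallel>d\<parallel>\<^sup>2\<close>.
  Conversely, if \<open>f\<close> is fixed, the two distances in \<open>step_decreases_distance\<close> are equal and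
  what remains is that no \<open>z\<close> has a smaller objective.
\<close>

lemma minimizer_iff_fixed_point:
  "is_minimizer (penalized_functional K g \<Gamma> \<phi> w p) f \<longleftrightarrow> step f = f"
proof
  assume "is_minimizer (penalized_functional K g \<Gamma> \<phi> w p) f"
  then have "finite_penalty f" "objective f \<le> objective (step f)"
    using finite_penalty_step unfolding is_minimizer_iff by auto
  then have "(norm (step f - f))\<^sup>2 \<le> 0" using step_decreases_objective[of f] by linarith
  then show "step f = f" by simp
next
  assume fixed: "step f = f"
  then have "finite_penalty f" using finite_penalty_step by metis
  then show "is_minimizer (penalized_functional K g \<Gamma> \<phi> w p) f"
    unfolding is_minimizer_iff using step_decreases_distance[of _ f] fixed by auto
qed

text \<open>
  The lower bound \<open>(p - 1) * M powr (p - 2)\<close> for the slope of \<open>sgn x * \<bar>x\<bar> powr (p - 1)\<close> on \<open>[- M, M]\<close>,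
  times the factor \<open>c * p / 2\<close> with which that function enters \<open>shrink_inverse\<close> for the smallest
  admissible weight. Steps whose coefficients are bounded by \<open>M\<close> shrink distances at least by
  the factor \<open>1 / (1 + contraction_gain M)\<close>.
\<close>

definition contraction_gain :: "real \<Rightarrow> real" where
  "contraction_gain M = c * p * (p - 1) / 2 * M powr (p - 2)"

lemma contraction_gain_nonneg: "contraction_gain M \<ge> 0"
  using c_pos p_ge_1 by (simp add: contraction_gain_def)

lemma contraction_gain_pos: "p > 1 \<Longrightarrow> M > 0 \<Longrightarrow> contraction_gain M > 0"
  using c_pos by (simp add: contraction_gain_def)

lemma step_strongly_nonexpansive:
  assumes "M > 0"
    and "\<And>\<gamma>. \<gamma> \<in> \<Gamma> \<Longrightarrow> \<bar>step f \<bullet> \<phi> \<gamma>\<bar> \<le> M" "\<And>\<gamma>. \<gamma> \<in> \<Gamma> \<Longrightarrow> \<bar>step f' \<bullet> \<phi> \<gamma>\<bar> \<le> M"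
  shows "(1 + contraction_gain M) * (norm (step f - step f'))\<^sup>2
      \<le> (step f - step f') \<bullet> ((f - f') - adjoint K (K (f - f')))"
proof (rule has_sum_mono)
  define h h' where "h = f + adjoint K (g - K f)" and "h' = f' + adjoint K (g - K f')"
  show "((\<lambda>\<gamma>. (1 + contraction_gain M) * ((step f - step f') \<bullet> \<phi> \<gamma>)\<^sup>2)
      has_sum (1 + contraction_gain M) * (norm (step f - step f'))\<^sup>2) \<Gamma>"
    by (intro has_sum_cmult_right parseval_norm)
  have "h - h' = (f - f') - adjoint K (K (f - f'))"
    unfolding h_def h'_def by (simp add: adjoint_diff K.diff algebra_simps)
  then show "((\<lambda>\<gamma>. ((step f - step f') \<bullet> \<phi> \<gamma>) * ((h - h') \<bullet> \<phi> \<gamma>))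
      has_sum (step f - step f') \<bullet> ((f - f') - adjoint K (K (f - f')))) \<Gamma>"
    using parseval[of "step f - step f'" "h - h'"] by simp
  fix \<gamma> assume \<gamma>: "\<gamma> \<in> \<Gamma>"
  have "step f \<bullet> \<phi> \<gamma> = shrink (w \<gamma>) p (h \<bullet> \<phi> \<gamma>)" "step f' \<bullet> \<phi> \<gamma> = shrink (w \<gamma>) p (h' \<bullet> \<phi> \<gamma>)"
    unfolding step_def h_def h'_def by (rule shrinkage_coefficient[OF \<gamma>])+
  then show "(1 + contraction_gain M) * ((step f - step f') \<bullet> \<phi> \<gamma>)\<^sup>2
      \<le> ((step f - step f') \<bullet> \<phi> \<gamma>) * ((h - h') \<bullet> \<phi> \<gamma>)"
    using shrink_strongly_nonexpansive[OF p_ge_1 p_le_2 c_pos weight_ge[OF \<gamma>] assms(1),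
        of "h \<bullet> \<phi> \<gamma>" "h' \<bullet> \<phi> \<gamma>"] assms(2,3)[OF \<gamma>]
    unfolding inner_diff_left contraction_gain_def by simp
qed

lemma step_contracts:
  assumes "M > 0"
    and "\<And>\<gamma>. \<gamma> \<in> \<Gamma> \<Longrightarrow> \<bar>step f \<bullet> \<phi> \<gamma>\<bar> \<le> M" "\<And>\<gamma>. \<gamma> \<in> \<Gamma> \<Longrightarrow> \<bar>step f' \<bullet> \<phi> \<gamma>\<bar> \<le> M"
  shows "(1 + contraction_gain M) * norm (step f - step f') \<le> norm (f - f')"
proof -
  let ?a = "step f - step f'" and ?b = "f - f'"
  have "(1 + contraction_gain M) * (norm ?a)\<^sup>2 \<le> ?a \<bullet> (?b - adjoint K (K ?b))"
    by (rule step_strongly_nonexpansive[OF assms])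
  also have "\<dots> \<le> norm ?a * norm (?b - adjoint K (K ?b))" by (rule norm_cauchy_schwarz)
  also have "\<dots> \<le> norm ?a * norm ?b" by (intro mult_left_mono norm_gradient_step_le) auto
  finally have "norm ?a * ((1 + contraction_gain M) * norm ?a) \<le> norm ?a * norm ?b"
    by (simp add: power2_eq_square mult_ac)
  then show ?thesis by (cases "?a = 0") (auto simp: mult_le_cancel_left_pos)
qed

lemma step_nonexpansive: "norm (step f - step f') \<le> norm (f - f')"
proof -
  \<comment> \<open>Any bound on the coefficients serves here; the summand \<open>1\<close> makes it positive.\<close>
  define M where "M = norm (step f) + norm (step f') + 1"
  have "(1 + contraction_gain M) * norm (step f - step f') \<le> norm (f - f')"
  proof (rule step_contracts)
    show "M > 0" unfolding M_def by (smt (verit) norm_ge_zero)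
    show "\<bar>step f \<bullet> \<phi> \<gamma>\<bar> \<le> M" "\<bar>step f' \<bullet> \<phi> \<gamma>\<bar> \<le> M" if "\<gamma> \<in> \<Gamma>" for \<gamma>
      unfolding M_def using abs_coefficient_le[OF that] norm_ge_zero by (smt (verit))+
  qed
  moreover have "0 \<le> contraction_gain M * norm (step f - step f')"
    by (intro mult_nonneg_nonneg contraction_gain_nonneg) auto
  ultimately show ?thesis by (simp add: distrib_right)
qed

text \<open>
  For fixed points, \<open>step_strongly_nonexpansive\<close> has the same difference \<open>a = f - f'\<close> on both
  sides, and \<open>a \<bullet> (a - K\<^sup>* K a) = \<parallel>a\<parallel>\<^sup>2 - \<parallel>K a\<parallel>\<^sup>2\<close>.
\<close>

lemma minimizer_unique:
  assumes "p > 1 \<or> {f. K f = 0} = {0}" "step f = f" "step f' = f'"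
  shows "f = f'"
proof -
  define M where "M = norm f + norm f' + 1"
  have M: "M > 0" unfolding M_def by (smt (verit) norm_ge_zero)
  have "(1 + contraction_gain M) * (norm (f - f'))\<^sup>2 \<le> (f - f') \<bullet> ((f - f') - adjoint K (K (f - f')))"
  proof -
    have "\<bar>step f \<bullet> \<phi> \<gamma>\<bar> \<le> M" "\<bar>step f' \<bullet> \<phi> \<gamma>\<bar> \<le> M" if "\<gamma> \<in> \<Gamma>" for \<gamma>
      unfolding M_def assms(2,3) using abs_coefficient_le[OF that] norm_ge_zero by (smt (verit))+
    then show ?thesis using step_strongly_nonexpansive[OF M, of f f'] by (simp add: assms(2,3))
  qed
  also have "\<dots> = (norm (f - f'))\<^sup>2 - (norm (K (f - f')))\<^sup>2"
    by (simp add: inner_diff_right[of "f - f'" "f - f'"] inner_adjoint dot_square_norm)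
  finally have le: "contraction_gain M * (norm (f - f'))\<^sup>2 + (norm (K (f - f')))\<^sup>2 \<le> 0"
    by (simp add: distrib_right)
  have nonneg: "0 \<le> contraction_gain M * (norm (f - f'))\<^sup>2"
    by (intro mult_nonneg_nonneg contraction_gain_nonneg) auto
  show ?thesis
  proof (cases "p > 1")
    case True
    have "contraction_gain M * (norm (f - f'))\<^sup>2 \<le> 0"
      using le zero_le_power2[of "norm (K (f - f'))"] by linarith
    then show ?thesis using contraction_gain_pos[OF True M] by (simp add: mult_le_0_iff)
  next
    case False
    have "(norm (K (f - f')))\<^sup>2 \<le> 0" using le nonneg by linarith
    then have "f - f' \<in> {f. K f = 0}" by simp
    also have "\<dots> = {0}" using assms(1) False by simp
    finally show ?thesis by simp
  qed
qed

end

section \<open>Convergence of the iterates\<close>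

text \<open>
  Closed bounded sets need not be compact in the ambient space, but the vectors \<open>\<Sum>\<gamma>\<in>F. a \<gamma> *\<^sub>R v \<gamma>\<close>
  with bounded coefficients lie in a finite sum of compact segments.
\<close>

lemma finite_box_in_compact:
  fixes v :: "'i \<Rightarrow> 'a::real_normed_vector" and M :: real
  assumes "finite F"
  shows "\<exists>B. compact B \<and> (\<forall>a. (\<forall>\<gamma>\<in>F. \<bar>a \<gamma>\<bar> \<le> M) \<longrightarrow> (\<Sum>\<gamma>\<in>F. a \<gamma> *\<^sub>R v \<gamma>) \<in> B)"
  using assms
proof (induction F)
  case empty
  show ?case by (rule exI[of _ "{0}"]) simp
next
  case (insert \<delta> F)
  then obtain B where B: "compact B"
    "\<And>a. (\<forall>\<gamma>\<in>F. \<bar>a \<gamma>\<bar> \<le> M) \<Longrightarrow> (\<Sum>\<gamma>\<in>F. a \<gamma> *\<^sub>R v \<gamma>) \<in> B" by blast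
  let ?C = "{x + y |x y. x \<in> (\<lambda>t. t *\<^sub>R v \<delta>) ` {- M..M} \<and> y \<in> B}"
  have "compact ?C"
    by (intro compact_sums B compact_continuous_image continuous_intros) auto
  moreover have "(\<Sum>\<gamma>\<in>insert \<delta> F. a \<gamma> *\<^sub>R v \<gamma>) \<in> ?C" if a: "\<forall>\<gamma>\<in>insert \<delta> F. \<bar>a \<gamma>\<bar> \<le> M" for a
  proof -
    have "a \<delta> \<in> {- M..M}" using a by auto
    moreover have "(\<Sum>\<gamma>\<in>F. a \<gamma> *\<^sub>R v \<gamma>) \<in> B" by (rule B) (use a in auto)
    moreover have "(\<Sum>\<gamma>\<in>insert \<delta> F. a \<gamma> *\<^sub>R v \<gamma>) = a \<delta> *\<^sub>R v \<delta> + (\<Sum>\<gamma>\<in>F. a \<gamma> *\<^sub>R v \<gamma>)"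
      using insert.hyps by simp
    ultimately show ?thesis by blast
  qed
  ultimately show ?case by blast
qed

context thresholded_landweber
begin

text \<open>
  Indices are shifted by one because an arbitrary starting point may have infinite penalty,
  whereas every result of a step has finite penalty.
\<close>

definition iterates :: "'a \<Rightarrow> nat \<Rightarrow> 'a" where
  "iterates f n = iterate K g \<Gamma> \<phi> w p f (Suc n)"

lemma iterates_Suc: "iterates f (Suc n) = step (iterates f n)"
  by (simp add: iterates_def step_def)

lemma finite_penalty_iterates: "finite_penalty (iterates f n)"
  by (simp add: iterates_def finite_penalty_shrinkage)

lemma decseq_objective: "decseq (\<lambda>n. objective (iterates f n))"
proof (rule decseq_SucI)
  fix n
  show "objective (iterates f (Suc n)) \<le> objective (iterates f n)"
    unfolding iterates_Suc
    using step_decreases_objective[OF finite_penalty_iterates[of f n]]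
      zero_le_power2[of "norm (step (iterates f n) - iterates f n)"] by linarith
qed

lemma objective_iterates_convergent:
  "\<exists>L. (\<lambda>n. objective (iterates f n)) \<longlonglongrightarrow> L \<and> (\<forall>n. L \<le> objective (iterates f n))"
  using decseq_convergent[OF decseq_objective[of f], of 0] objective_nonneg by blast

lemma asymptotically_regular: "(\<lambda>n. norm (iterates f (Suc n) - iterates f n)) \<longlonglongrightarrow> 0"
proof -
  obtain L where L: "(\<lambda>n. objective (iterates f n)) \<longlonglongrightarrow> L"
    using objective_iterates_convergent by blast
  have "(\<lambda>n. objective (iterates f n) - objective (iterates f (Suc n))) \<longlonglongrightarrow> L - L"
    by (intro tendsto_diff L LIMSEQ_Suc[OF L])
  then have lim: "(\<lambda>n. objective (iterates f n) - objective (iterates f (Suc n))) \<longlonglongrightarrow> 0" by simp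
  have "(\<lambda>n. (norm (iterates f (Suc n) - iterates f n))\<^sup>2) \<longlonglongrightarrow> 0"
  proof (rule tendsto_sandwich[OF _ _ tendsto_const lim])
    show "\<forall>\<^sub>F n in sequentially. (norm (iterates f (Suc n) - iterates f n))\<^sup>2
        \<le> objective (iterates f n) - objective (iterates f (Suc n))"
      using step_decreases_objective[OF finite_penalty_iterates[of f]]
      by (intro always_eventually allI) (simp add: iterates_Suc algebra_simps)
  qed simp
  then show ?thesis by (simp add: power_tendsto_0_iff)
qed

text \<open>
  If the objective stayed above \<open>objective z\<close> by a fixed amount, every step would bring the
  iterates closer to \<open>z\<close> by that amount in squared distance, which cannot go on forever.
\<close>

lemma objective_limit_le:
  assumes L: "\<And>n. L \<le> objective (iterates f n)" and z: "finite_penalty z"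
  shows "L \<le> objective z"
proof (rule ccontr)
  assume "\<not> L \<le> objective z"
  then have \<delta>: "L - objective z > 0" by simp
  define d where "d n = (norm (z - iterates f n))\<^sup>2" for n
  have "d n + n * (L - objective z) \<le> d 0" for n
  proof (induction n)
    case (Suc n)
    have "objective (iterates f (Suc n)) + d (Suc n) \<le> objective z + d n"
      unfolding d_def iterates_Suc by (rule step_decreases_distance[OF z])
    then show ?case using Suc L[of "Suc n"] by (simp add: algebra_simps)
  qed simp
  moreover have "d n \<ge> 0" for n by (simp add: d_def)
  ultimately have "n * (L - objective z) \<le> d 0" for n :: nat by (smt (verit))
  then show False using reals_Archimedean3[OF \<delta>] by (metis linorder_not_le)
qed

text \<open>
  Asymptotic regularity turns the limit of a subsequence into a fixed point. The distance
  to a fixed point never increases under a nonexpansive step, so smallness along the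
  subsequence is smallness along the whole sequence.
\<close>

lemma subsequential_limit_is_limit:
  assumes r: "strict_mono r" and l: "(\<lambda>k. iterates f (r k)) \<longlonglongrightarrow> l"
  shows "step l = l" "iterates f \<longlonglongrightarrow> l"
proof -
  show fixed: "step l = l"
  proof (rule LIMSEQ_unique)
    have "(\<lambda>k. norm (iterates f (Suc (r k)) - iterates f (r k))) \<longlonglongrightarrow> 0"
      using LIMSEQ_subseq_LIMSEQ[OF asymptotically_regular r] by (simp add: o_def)
    then have "(\<lambda>k. iterates f (Suc (r k)) - iterates f (r k)) \<longlonglongrightarrow> 0"
      by (rule tendsto_norm_zero_cancel)
    from tendsto_add[OF this l] show "(\<lambda>k. iterates f (Suc (r k))) \<longlonglongrightarrow> l" by simp
    have "(\<lambda>k. norm (iterates f (r k) - l)) \<longlonglongrightarrow> 0"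
      using l by (simp add: LIM_zero_iff tendsto_norm_zero_iff)
    then have "(\<lambda>k. norm (iterates f (Suc (r k)) - step l)) \<longlonglongrightarrow> 0"
      by (rule tendsto_sandwich[OF _ _ tendsto_const, rotated 2])
        (auto simp: iterates_Suc step_nonexpansive)
    then show "(\<lambda>k. iterates f (Suc (r k))) \<longlonglongrightarrow> step l"
      using LIM_zero_iff tendsto_norm_zero_iff by blast
  qed
  have "decseq (\<lambda>n. dist (iterates f n) l)"
  proof (rule decseq_SucI)
    fix n show "dist (iterates f (Suc n)) l \<le> dist (iterates f n) l"
      using step_nonexpansive[of "iterates f n" l] by (simp add: dist_norm iterates_Suc fixed)
  qed
  then have mono: "dist (iterates f n) l \<le> dist (iterates f m) l" if "m \<le> n" for m n
    using that by (simp add: decseq_def)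
  show "iterates f \<longlonglongrightarrow> l" unfolding lim_sequentially
  proof (intro allI impI)
    fix e :: real assume "e > 0"
    then obtain k where "dist (iterates f (r k)) l < e"
      using l unfolding lim_sequentially by blast
    then show "\<exists>N. \<forall>n\<ge>N. dist (iterates f n) l < e" using mono by (meson le_less_trans)
  qed
qed

text \<open>
  A single term of the penalty, whose weight is at least \<open>c\<close>, is bounded by the initial objective.
\<close>

lemma coefficients_bounded:
  "\<exists>M>0. \<forall>n. \<forall>\<gamma>\<in>\<Gamma>. \<bar>iterates f n \<bullet> \<phi> \<gamma>\<bar> \<le> M"
proof -
  define J where "J = objective (iterates f 0)"
  have "\<bar>iterates f n \<bullet> \<phi> \<gamma>\<bar> \<le> (J / c) powr (1 / p) + 1" if \<gamma>: "\<gamma> \<in> \<Gamma>" for n \<gamma>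
  proof -
    let ?x = "\<bar>iterates f n \<bullet> \<phi> \<gamma>\<bar>"
    have "c * ?x powr p \<le> w \<gamma> * ?x powr p" using weight_ge[OF \<gamma>] by (intro mult_right_mono) auto
    also have "\<dots> = (\<Sum>\<gamma>\<in>{\<gamma>}. w \<gamma> * \<bar>iterates f n \<bullet> \<phi> \<gamma>\<bar> powr p)" by simp
    also have "\<dots> \<le> penalty (iterates f n)"
      by (rule finite_sum_le_has_sum[OF penalty_has_sum[OF finite_penalty_iterates]])
        (use \<gamma> weight_pos in \<open>auto simp: less_imp_le\<close>)
    also have "\<dots> \<le> objective (iterates f n)" by (simp add: objective_def)
    also have "\<dots> \<le> J" unfolding J_def using decseqD[OF decseq_objective] by simp
    finally have "?x powr p \<le> J / c" using c_pos by (simp add: field_simps)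
    then have "(?x powr p) powr (1 / p) \<le> (J / c) powr (1 / p)"
      using p_ge_1 by (intro powr_mono2) auto
    then show ?thesis using p_ge_1 by (simp add: powr_powr)
  qed
  moreover have "(J / c) powr (1 / p) + 1 > 0" by (smt (verit) powr_ge_zero)
  ultimately show ?thesis by blast
qed

text \<open>
  The distance \<open>D\<close> of two iterates is at most the distance of their successors, which is
  \<open>\<le> D / (1 + \<kappa>)\<close>, plus the two step lengths. So \<open>D\<close> is bounded by a multiple of the step
  lengths, and these tend to \<open>0\<close>.
\<close>

lemma iterates_converge_if_p_gt_1:
  assumes "p > 1"
  shows "\<exists>l. step l = l \<and> iterates f \<longlonglongrightarrow> l"
proof -
  obtain M where M: "M > 0" "\<And>n \<gamma>. \<gamma> \<in> \<Gamma> \<Longrightarrow> \<bar>iterates f n \<bullet> \<phi> \<gamma>\<bar> \<le> M"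
    using coefficients_bounded by blast
  define \<kappa> where "\<kappa> = contraction_gain M"
  have \<kappa>: "\<kappa> > 0" unfolding \<kappa>_def by (rule contraction_gain_pos[OF assms M(1)])
  define C where "C = (1 + \<kappa>) / \<kappa>"
  have C: "C > 0" unfolding C_def using \<kappa> by simp
  define \<epsilon> where "\<epsilon> n = norm (iterates f (Suc n) - iterates f n)" for n
  have close: "norm (iterates f m - iterates f n) \<le> C * (\<epsilon> m + \<epsilon> n)" for m n
  proof -
    let ?D = "norm (iterates f m - iterates f n)"
    let ?D' = "norm (iterates f (Suc m) - iterates f (Suc n))"
    have D': "(1 + \<kappa>) * ?D' \<le> ?D" unfolding \<kappa>_def iterates_Suc
      by (rule step_contracts[OF M(1)]) (use M(2) in \<open>auto simp flip: iterates_Suc\<close>)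
    have "iterates f m - iterates f n = (iterates f (Suc m) - iterates f (Suc n))
        - (iterates f (Suc m) - iterates f m) + (iterates f (Suc n) - iterates f n)" by simp
    then have "?D \<le> ?D' + \<epsilon> m + \<epsilon> n"
      unfolding \<epsilon>_def by (metis norm_triangle_le norm_triangle_le_diff add_right_mono order_refl)
    then have "(1 + \<kappa>) * ?D \<le> (1 + \<kappa>) * (?D' + \<epsilon> m + \<epsilon> n)" using \<kappa> by (intro mult_left_mono) auto
    then have "\<kappa> * ?D \<le> (1 + \<kappa>) * (\<epsilon> m + \<epsilon> n)" using D' by (simp add: algebra_simps)
    then show ?thesis unfolding C_def using \<kappa> by (simp add: field_simps)
  qed
  have \<epsilon>: "\<epsilon> \<longlonglongrightarrow> 0" unfolding \<epsilon>_def by (rule asymptotically_regular)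
  have "Cauchy (iterates f)" unfolding Cauchy_def
  proof (intro allI impI)
    fix e :: real assume e: "e > 0"
    define \<eta> where "\<eta> = e / (2 * C)"
    have "\<eta> > 0" unfolding \<eta>_def using e C by simp
    then obtain N where N: "\<And>n. n \<ge> N \<Longrightarrow> \<epsilon> n < \<eta>"
      using order_tendstoD(2)[OF \<epsilon>] unfolding eventually_sequentially by blast
    have "dist (iterates f m) (iterates f n) < e" if "m \<ge> N" "n \<ge> N" for m n
    proof -
      have "norm (iterates f m - iterates f n) \<le> C * (\<epsilon> m + \<epsilon> n)" by (rule close)
      also have "\<dots> < C * (\<eta> + \<eta>)"
        using N[OF that(1)] N[OF that(2)] C by (intro mult_strict_left_mono add_strict_mono) auto
      also have "\<dots> = e" unfolding \<eta>_def using C by simp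
      finally show ?thesis by (simp add: dist_norm)
    qed
    then show "\<exists>N. \<forall>m\<ge>N. \<forall>n\<ge>N. dist (iterates f m) (iterates f n) < e" by blast
  qed
  then obtain l where "iterates f \<longlonglongrightarrow> l" using Cauchy_convergent convergent_def by blast
  \<comment> \<open>The sequence is a subsequence of itself, which identifies the limit as a fixed point.\<close>
  then show ?thesis using subsequential_limit_is_limit[of id f l] by (auto simp: strict_mono_id)
qed

lemma penalty_midpoint:
  assumes "p = 1" "finite_penalty a" "finite_penalty b"
  defines "m \<equiv> (1 / 2) *\<^sub>R (a + b)"
  shows "finite_penalty m" "penalty m \<le> (penalty a + penalty b) / 2"
proof -
  have hs: "((\<lambda>\<gamma>. 1 / 2 * (w \<gamma> * \<bar>a \<bullet> \<phi> \<gamma>\<bar> powr p + w \<gamma> * \<bar>b \<bullet> \<phi> \<gamma>\<bar> powr p))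
      has_sum 1 / 2 * (penalty a + penalty b)) \<Gamma>"
    by (intro has_sum_cmult_right has_sum_add penalty_has_sum assms)
  have le: "w \<gamma> * \<bar>m \<bullet> \<phi> \<gamma>\<bar> powr p
      \<le> 1 / 2 * (w \<gamma> * \<bar>a \<bullet> \<phi> \<gamma>\<bar> powr p + w \<gamma> * \<bar>b \<bullet> \<phi> \<gamma>\<bar> powr p)" if "\<gamma> \<in> \<Gamma>" for \<gamma>
  proof -
    have "w \<gamma> * \<bar>m \<bullet> \<phi> \<gamma>\<bar> \<le> w \<gamma> * (1 / 2 * (\<bar>a \<bullet> \<phi> \<gamma>\<bar> + \<bar>b \<bullet> \<phi> \<gamma>\<bar>))"
      using weight_pos[OF that] unfolding m_def
      by (intro mult_left_mono) (auto simp: inner_add_left)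
    then show ?thesis using assms(1) by (simp add: algebra_simps)
  qed
  show fin: "finite_penalty m" unfolding finite_penalty_def
    by (rule summable_on_comparison_test[OF has_sum_imp_summable[OF hs]])
      (use le weight_pos in \<open>auto simp: less_imp_le\<close>)
  show "penalty m \<le> (penalty a + penalty b) / 2"
    using has_sum_mono[OF penalty_has_sum[OF fin] hs le] by simp
qed

text \<open>
  By the parallelogram law the misfit at the midpoint of \<open>a\<close> and \<open>b\<close> is smaller than the average
  misfit by \<open>\<parallel>K a - K b\<parallel>\<^sup>2 / 4\<close>, whereas the objective there cannot drop below \<open>L\<close>.
\<close>

lemma image_gap_le_objective_gap:
  assumes "p = 1" "finite_penalty a" "finite_penalty b"
    and L: "\<And>z. finite_penalty z \<Longrightarrow> L \<le> objective z"
  shows "(norm (K a - K b))\<^sup>2 \<le> 2 * (objective a - L) + 2 * (objective b - L)"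
proof -
  define m where "m = (1 / 2) *\<^sub>R (a + b)"
  have Km: "K m - g = (1 / 2) *\<^sub>R ((K a - g) + (K b - g))"
    unfolding m_def by (simp add: K.scaleR K.add algebra_simps flip: scaleR_add_left)
  have "4 * (norm (K m - g))\<^sup>2 = (norm ((K a - g) + (K b - g)))\<^sup>2"
    unfolding Km by (simp add: power_divide)
  moreover have "(norm ((K a - g) - (K b - g)))\<^sup>2
      = 2 * (norm (K a - g))\<^sup>2 + 2 * (norm (K b - g))\<^sup>2 - (norm ((K a - g) + (K b - g)))\<^sup>2"
    unfolding power2_norm_eq_inner
    by (simp only: inner_diff_left inner_diff_right inner_add_left inner_add_right) simp
  ultimately have "(norm (K a - K b))\<^sup>2
      = 2 * (norm (K a - g))\<^sup>2 + 2 * (norm (K b - g))\<^sup>2 - 4 * (norm (K m - g))\<^sup>2"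
    by simp
  moreover have "L \<le> objective m" "penalty m \<le> (penalty a + penalty b) / 2"
    using L penalty_midpoint[OF assms(1-3)] by (auto simp: m_def)
  ultimately show ?thesis unfolding objective_def by argo
qed

text \<open>
  The iterates are a minimizing sequence, so \<open>image_gap_le_objective_gap\<close> makes their images
  under \<open>K\<close> a Cauchy sequence.
\<close>

lemma gradient_converges_if_p_eq_1:
  assumes "p = 1"
  shows "\<exists>u. (\<lambda>n. adjoint K (g - K (iterates f n))) \<longlonglongrightarrow> u"
proof -
  obtain L where L: "(\<lambda>n. objective (iterates f n)) \<longlonglongrightarrow> L" "\<And>n. L \<le> objective (iterates f n)"
    using objective_iterates_convergent by blast
  have inf: "L \<le> objective z" if "finite_penalty z" for z
    by (rule objective_limit_le[OF L(2) that])
  have "Cauchy (\<lambda>n. adjoint K (g - K (iterates f n)))" unfolding Cauchy_def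
  proof (intro allI impI)
    fix e :: real assume e: "e > 0"
    then obtain N where N: "\<And>n. n \<ge> N \<Longrightarrow> objective (iterates f n) - L < e\<^sup>2 / 4"
      using L unfolding lim_sequentially dist_real_def
      by (metis abs_of_nonneg diff_ge_0_iff_ge zero_less_divide_iff zero_less_numeral zero_less_power)
    have "dist (adjoint K (g - K (iterates f m))) (adjoint K (g - K (iterates f n))) < e"
      if "m \<ge> N" "n \<ge> N" for m n
    proof -
      have "(norm (K (iterates f n) - K (iterates f m)))\<^sup>2
          \<le> 2 * (objective (iterates f n) - L) + 2 * (objective (iterates f m) - L)"
        by (intro image_gap_le_objective_gap assms finite_penalty_iterates inf)
      also have "\<dots> < e\<^sup>2" using N[OF that(1)] N[OF that(2)] by simp
      finally have "norm (K (iterates f n) - K (iterates f m)) < e"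
        using e by (simp add: power2_less_imp_less)
      then show ?thesis
        using norm_adjoint_le[of "K (iterates f n) - K (iterates f m)"]
        by (simp add: dist_norm flip: adjoint_diff)
    qed
    then show "\<exists>N. \<forall>m\<ge>N. \<forall>n\<ge>N.
        dist (adjoint K (g - K (iterates f m))) (adjoint K (g - K (iterates f n))) < e" by blast
  qed
  then show ?thesis using Cauchy_convergent convergent_def by blast
qed

text \<open>
  Let \<open>v\<close> be the limit of the gradient terms. Outside a finite set \<open>\<bar>v \<bullet> \<phi> \<gamma>\<bar> \<le> c / 8\<close>, and
  eventually the gradient terms differ from \<open>v\<close> by less than \<open>c / 8\<close>. There a step adds at most
  \<open>c / 4\<close> to the modulus of a coefficient before the threshold \<open>w \<gamma> / 2 \<ge> c / 2\<close> is
  subtracted, a net loss of at least \<open>c / 4\<close> until \<open>0\<close> is reached.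
\<close>

lemma iterates_finitely_supported_if_p_eq_1:
  assumes "p = 1"
  shows "\<exists>F N. finite F \<and> F \<subseteq> \<Gamma> \<and> (\<forall>n\<ge>N. \<forall>\<gamma>\<in>\<Gamma> - F. iterates f n \<bullet> \<phi> \<gamma> = 0)"
proof -
  define u where "u n = adjoint K (g - K (iterates f n))" for n
  obtain v where v: "u \<longlonglongrightarrow> v"
    using gradient_converges_if_p_eq_1[OF assms] unfolding u_def by blast
  obtain F where F: "finite F" "F \<subseteq> \<Gamma>" "\<And>\<gamma>. \<gamma> \<in> \<Gamma> - F \<Longrightarrow> \<bar>v \<bullet> \<phi> \<gamma>\<bar> \<le> c / 8"
    using finitely_many_large_coefficients[of "c / 8" v] c_pos by auto
  obtain N where N: "\<And>n. n \<ge> N \<Longrightarrow> norm (u n - v) < c / 8"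
    using v c_pos unfolding lim_sequentially dist_norm by (metis zero_less_divide_iff zero_less_numeral)
  obtain M where M: "M > 0" "\<And>n \<gamma>. \<gamma> \<in> \<Gamma> \<Longrightarrow> \<bar>iterates f n \<bullet> \<phi> \<gamma>\<bar> \<le> M"
    using coefficients_bounded by blast
  have decay: "\<bar>iterates f (N + k) \<bullet> \<phi> \<gamma>\<bar> \<le> max 0 (M - k * (c / 4))"
    if \<gamma>: "\<gamma> \<in> \<Gamma> - F" for k \<gamma>
  proof (induction k)
    case 0
    then show ?case using M \<gamma> by auto
  next
    case (Suc k)
    let ?x = "iterates f (N + k) \<bullet> \<phi> \<gamma>" and ?u = "u (N + k) \<bullet> \<phi> \<gamma>"
    have "\<bar>(u (N + k) - v) \<bullet> \<phi> \<gamma>\<bar> \<le> c / 8"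
      using abs_coefficient_le[of \<gamma> "u (N + k) - v"] N[of "N + k"] \<gamma> by auto
    then have u: "\<bar>?u\<bar> \<le> c / 4" using F(3)[OF \<gamma>] unfolding inner_diff_left by linarith
    have "iterates f (N + Suc k) \<bullet> \<phi> \<gamma> = shrink (w \<gamma>) p (?x + ?u)"
      using \<gamma> by (simp add: iterates_Suc step_def u_def shrinkage_coefficient inner_add_left)
    then have "\<bar>iterates f (N + Suc k) \<bullet> \<phi> \<gamma>\<bar> \<le> max 0 (\<bar>?x + ?u\<bar> - w \<gamma> / 2)"
      using soft_threshold_bound[of "w \<gamma>" "?x + ?u"] weight_pos \<gamma> assms by simp
    also have "\<dots> \<le> max 0 (\<bar>?x\<bar> - c / 4)" using u weight_ge[of \<gamma>] \<gamma> by auto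
    also have "\<dots> \<le> max 0 (M - Suc k * (c / 4))" 
    proof -
      have "Suc k * (c / 4) = k * (c / 4) + c / 4" by (simp add: distrib_right)
      then show ?thesis using Suc c_pos by linarith
    qed
    finally show ?case .
  qed
  \<comment> \<open>A number of steps that works for every \<open>\<gamma>\<close> outside \<open>F\<close>, by the uniform bound \<open>M\<close>.\<close>
  obtain k :: nat where k: "M < k * (c / 4)"
    using reals_Archimedean3[of "c / 4"] c_pos by auto
  have "iterates f n \<bullet> \<phi> \<gamma> = 0" if "n \<ge> N + k" "\<gamma> \<in> \<Gamma> - F" for n \<gamma>
  proof -
    define j where "j = n - N"
    have j: "n = N + j" "j \<ge> k" using that(1) by (auto simp: j_def)
    have "k * (c / 4) \<le> j * (c / 4)" using j c_pos by (intro mult_right_mono) auto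
    then show ?thesis using decay[OF that(2), of j] k j by simp
  qed
  then show ?thesis using F by blast
qed

lemma iterates_converge_if_p_eq_1:
  assumes "p = 1"
  shows "\<exists>l. step l = l \<and> iterates f \<longlonglongrightarrow> l"
proof -
  obtain F N where F: "finite F" "F \<subseteq> \<Gamma>" "\<And>n \<gamma>. n \<ge> N \<Longrightarrow> \<gamma> \<in> \<Gamma> - F \<Longrightarrow> iterates f n \<bullet> \<phi> \<gamma> = 0"
    using iterates_finitely_supported_if_p_eq_1[OF assms, of f] by blast
  obtain M where M: "M > 0" "\<And>n \<gamma>. \<gamma> \<in> \<Gamma> \<Longrightarrow> \<bar>iterates f n \<bullet> \<phi> \<gamma>\<bar> \<le> M"
    using coefficients_bounded by blast
  obtain B where B: "compact B"
    "\<And>a. (\<forall>\<gamma>\<in>F. \<bar>a \<gamma>\<bar> \<le> M) \<Longrightarrow> (\<Sum>\<gamma>\<in>F. a \<gamma> *\<^sub>R \<phi> \<gamma>) \<in> B"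
    using finite_box_in_compact[OF F(1), of M \<phi>] by blast
  have "\<forall>n. iterates f (N + n) \<in> B"
  proof
    fix n
    let ?a = "\<lambda>\<gamma>. iterates f (N + n) \<bullet> \<phi> \<gamma>"
    have "iterates f (N + n) = (\<Sum>\<gamma>\<in>F. ?a \<gamma> *\<^sub>R \<phi> \<gamma>)"
      by (rule eq_if_coefficients_eq) (use F in \<open>auto simp: inner_sum_basis\<close>)
    also have "\<dots> \<in> B" by (rule B) (use M(2) F(2) in auto)
    finally show "iterates f (N + n) \<in> B" .
  qed
  then obtain l r where r: "strict_mono r" "((\<lambda>n. iterates f (N + n)) \<circ> r) \<longlonglongrightarrow> l"
    by (rule seq_compactE[OF compact_imp_seq_compact[OF B(1)]])
  have "strict_mono (\<lambda>k. N + r k)" using r(1) by (simp add: strict_mono_def)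
  then show ?thesis using subsequential_limit_is_limit[of "\<lambda>k. N + r k" f l] r(2)
    by (auto simp: o_def)
qed

lemma iterate_converges_to_minimizer:
  "\<exists>l. is_minimizer (penalized_functional K g \<Gamma> \<phi> w p) l \<and> iterate K g \<Gamma> \<phi> w p f \<longlonglongrightarrow> l"
proof -
  have "\<exists>l. step l = l \<and> iterates f \<longlonglongrightarrow> l"
    using iterates_converge_if_p_gt_1 iterates_converge_if_p_eq_1 p_ge_1 by fastforce
  then obtain l where l: "step l = l" "iterates f \<longlonglongrightarrow> l" by blast
  have "iterate K g \<Gamma> \<phi> w p f \<longlonglongrightarrow> l"
    using l(2) unfolding iterates_def[abs_def] by (rule LIMSEQ_imp_Suc)
  then show ?thesis using l(1) minimizer_iff_fixed_point by blast
qed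

end

theorem theorem3p1:
  fixes K :: "'a::{real_inner, complete_space} \<Rightarrow> 'b::{real_inner, complete_space}"
    and g :: 'b
    and \<Gamma> :: "'i set"
    and \<phi> :: "'i \<Rightarrow> 'a"
    and w :: "'i \<Rightarrow> real"
    and p c :: real
  assumes "bounded_linear K"
    and "onorm K < 1"
    and "orthonormal_basis \<Gamma> \<phi>"
    and "1 \<le> p" and "p \<le> 2"
    and "c > 0"
    and "\<And>\<gamma>. \<gamma> \<in> \<Gamma> \<Longrightarrow> c \<le> w \<gamma>"
  shows "(\<forall>f0. \<exists>fstar. is_minimizer (penalized_functional K g \<Gamma> \<phi> w p) fstar \<and>
              iterate K g \<Gamma> \<phi> w p f0 \<longlonglongrightarrow> fstar) \<and>
         (p > 1 \<or> {f. K f = 0} = {0} \<longrightarrow>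
            (\<exists>fstar. is_minimizer (penalized_functional K g \<Gamma> \<phi> w p) fstar \<and>
               (\<forall>f. is_minimizer (penalized_functional K g \<Gamma> \<phi> w p) f \<longrightarrow> f = fstar) \<and>
               (\<forall>f0. iterate K g \<Gamma> \<phi> w p f0 \<longlonglongrightarrow> fstar)))"
proof -
  interpret thresholded_landweber \<Gamma> \<phi> K g w p c
    by (intro thresholded_landweber.intro orthonormal_basis_on.intro
        thresholded_landweber_axioms.intro assms)
  show ?thesis
  proof (intro conjI impI allI)
    show "\<exists>fstar. is_minimizer (penalized_functional K g \<Gamma> \<phi> w p) fstar \<and>
        iterate K g \<Gamma> \<phi> w p f0 \<longlonglongrightarrow> fstar" for f0
      by (rule iterate_converges_to_minimizer)
    assume unique: "p > 1 \<or> {f. K f = 0} = {0}"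
    obtain fstar where fstar: "is_minimizer (penalized_functional K g \<Gamma> \<phi> w p) fstar"
      using iterate_converges_to_minimizer by blast
    have eq: "f = fstar" if "is_minimizer (penalized_functional K g \<Gamma> \<phi> w p) f" for f
      using minimizer_unique[OF unique, of f fstar] that fstar minimizer_iff_fixed_point by blast
    have "iterate K g \<Gamma> \<phi> w p f0 \<longlonglongrightarrow> fstar" for f0
      using iterate_converges_to_minimizer[of f0] eq by blast
    then show "\<exists>fstar. is_minimizer (penalized_functional K g \<Gamma> \<phi> w p) fstar \<and>
        (\<forall>f. is_minimizer (penalized_functional K g \<Gamma> \<phi> w p) f \<longrightarrow> f = fstar) \<and>
        (\<forall>f0. iterate K g \<Gamma> \<phi> w p f0 \<longlonglongrightarrow> fstar)"
      using fstar eq by blast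
  qed
qed

end
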